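(* Let $(M,\eta,\tilde g,\phi)$ be a closed regular non-Sasakian $(\kappa,\mu)$-manifold with Boothby-Wang fibration $\pi:M\to(B,\omega)$. Suppose $(T,f,g)$ is a solution to the equation $$\tilde g(TX,Y)=\tilde g(X,Y)-e^{2f}g(d\pi X,d\pi Y)\quad\text{for all }X,Y\in\Gamma(\mathrm{Ker}(\eta)),$$ and $hT=Th$. Then: (1) The Boeckx index $I_M$ satisfies $|I_M|>1$. (2) The error tensor $T$ has two eigenvalues, with the eigenspaces coinciding with those of $h$ (on $\mathrm{Ker}(\eta)$), namely $\mathscr D_h(\lambda)$ and $\mathscr D_h(-\lambda)$. The eigenvalues, and consequently $T$ itself, are determined by the function $f$. (3) The metric $g$ is independent of the choice of $f$ and $T$; that is, any two solutions $(T,f,g)$ and $(T',f',g')$ with $hT=Th$ and $hT'=T'h$ satisfy $g=g'$.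
   Context: A contact metric manifold $(M^{2n+1},\eta,\tilde g,\phi)$ consists of a contact form $\eta$ with Reeb field $\xi$ ($\eta(\xi)=1$, $d\eta(\xi,\cdot)=0$), a Riemannian metric $\tilde g$ and a $(1,1)$-tensor field $\phi$ with $\eta=i_\xi\tilde g$, $\phi^2=-I+\eta\otimes\xi$, $d\eta(X,Y)=\tilde g(X,\phi Y)$. Put $h=\frac12\mathcal L_\xi\phi$. It is a $(\kappa,\mu)$-manifold ($\kappa,\mu\in\mathbb R$ constants) if $R(X,Y)\xi=\kappa(\eta(Y)X-\eta(X)Y)+\mu(\eta(Y)hX-\eta(X)hY)$; it is Sasakian iff $\kappa=1$, and non-Sasakian means $\kappa<1$. In that case $h$ is $\tilde g$-symmetric, $h^2=-(1-\kappa)\phi^2$ (the convention for $d\eta$ is the standard one in contact metric geometry, with the factor $\frac12$, for which this holds), and $h$ has eigenvalues $0,\lambda,-\lambda$ with $\lambda=\sqrt{1-\kappa}$; $\mathscr D_h(\pm\lambda)$ denote the eigendistributions, which are mutually orthogonal, of rank $n$, and span $\mathrm{Ker}(\eta)$. The Boeckx index is $I_M=\dfrac{1-\mu/2}{\sqrt{1-\kappa}}$. Boothby-Wang fibration: $M$ is closed and $\xi$ is regular; $\eta$ is taken so that the flow of $\xi$ generates a free $\mathbb S^1$-action, $\pi:M\to B$ is the resulting principal $\mathbb S^1$-bundle with fibers the orbits of $\xi$, and $\omega$ is the symplectic form on $B$ with $\pi^*\omega=d\eta$. A solution $(T,f,g)$ of the displayed equation consists of a function $f\in C^\infty(M)$,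 a Riemannian metric $g$ on $B$ associated with $\omega$ (i.e. there is an almost complex structure $J$ on $B$ with $g(X,JY)=\omega(X,Y)$), and the $(1,1)$-tensor field $T$ on $\mathrm{Ker}(\eta)$ (the error tensor) satisfying the equation. The condition $hT=Th$ is understood on $\mathrm{Ker}(\eta)$. *)

theory Defs
  imports "HOL-Analysis.Analysis" "HOL-Library.Function_Algebras"
begin

section \<open>Smooth maps between open subsets of Euclidean spaces\<close>

primrec Ck_on :: "nat \<Rightarrow> 'e::euclidean_space set \<Rightarrow> ('e \<Rightarrow> 'f::real_normed_vector) \<Rightarrow> bool" where
  "Ck_on 0 S f \<longleftrightarrow> continuous_on S f"
| "Ck_on (Suc k) S f \<longleftrightarrow>
     (\<forall>x\<in>S. f differentiable (at x)) \<and> (\<forall>v. Ck_on k S (\<lambda>x. frechet_derivative f (at x) v))"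

definition smooth_on :: "'e::euclidean_space set \<Rightarrow> ('e \<Rightarrow> 'f::real_normed_vector) \<Rightarrow> bool" where
  "smooth_on S f \<longleftrightarrow> (\<forall>k. Ck_on k S f)"

text \<open>\<open>dird f x v\<close> is the derivative of \<open>f\<close> at \<open>x\<close> in direction \<open>v\<close>.\<close>

abbreviation dird :: "('e::euclidean_space \<Rightarrow> 'f::real_normed_vector) \<Rightarrow> 'e \<Rightarrow> 'e \<Rightarrow> 'f" where
  "dird f x v \<equiv> frechet_derivative f (at x) v"


section \<open>Smooth manifolds\<close>

text \<open>
  A chart is a pair of its domain and a coordinate map, of which only the values on the domain
  matter. The underlying set of a manifold is a whole type; its smooth structure is
  a maximal atlas \<open>A\<close>, and its dimension is \<open>DIM('e)\<close>.
\<close>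

type_synonym ('m, 'e) chart = "'m set \<times> ('m \<Rightarrow> 'e)"

abbreviation chart_dom :: "('m, 'e) chart \<Rightarrow> 'm set" where "chart_dom \<equiv> fst"
abbreviation chart_map :: "('m, 'e) chart \<Rightarrow> 'm \<Rightarrow> 'e" where "chart_map \<equiv> snd"

definition chart_inv :: "('m, 'e) chart \<Rightarrow> 'e \<Rightarrow> 'm" where
  "chart_inv c = inv_into (chart_dom c) (chart_map c)"

definition chart_ran :: "('m, 'e) chart \<Rightarrow> 'e set" where
  "chart_ran c = chart_map c ` chart_dom c"

definition is_chart :: "('m::topological_space, 'e::euclidean_space) chart \<Rightarrow> bool" where
  "is_chart c \<longleftrightarrow> open (chart_dom c) \<and> open (chart_ran c) \<and>
     homeomorphism (chart_dom c) (chart_ran c) (chart_map c) (chart_inv c)"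

definition transition :: "('m, 'e) chart \<Rightarrow> ('m, 'e) chart \<Rightarrow> 'e \<Rightarrow> 'e" where
  "transition c c' = chart_map c' \<circ> chart_inv c"

definition compatible :: "('m, 'e::euclidean_space) chart \<Rightarrow> ('m, 'e) chart \<Rightarrow> bool" where
  "compatible c c' \<longleftrightarrow>
     smooth_on (chart_map c ` (chart_dom c \<inter> chart_dom c')) (transition c c') \<and>
     smooth_on (chart_map c' ` (chart_dom c \<inter> chart_dom c')) (transition c' c)"

definition smooth_structure ::
  "('m::{t2_space, second_countable_topology}, 'e::euclidean_space) chart set \<Rightarrow> bool" where
  "smooth_structure A \<longleftrightarrow>
     (\<forall>c\<in>A. is_chart c) \<and> (\<Union>c\<in>A. chart_dom c) = UNIV \<and>
     (\<forall>c\<in>A. \<forall>c'\<in>A. compatible c c') \<and>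
     (\<forall>c. is_chart c \<and> (\<forall>c'\<in>A. compatible c c') \<longrightarrow> c \<in> A)"

definition charts_at :: "('m, 'e) chart set \<Rightarrow> 'm \<Rightarrow> ('m, 'e) chart set" where
  "charts_at A p = {c \<in> A. p \<in> chart_dom c}"

definition smooth_map_on ::
  "('m::topological_space, 'e::euclidean_space) chart set \<Rightarrow>
   ('b::topological_space, 'f::euclidean_space) chart set \<Rightarrow> 'm set \<Rightarrow> ('m \<Rightarrow> 'b) \<Rightarrow> bool" where
  "smooth_map_on A B V F \<longleftrightarrow> open V \<and> continuous_on V F \<and>
     (\<forall>c\<in>A. \<forall>d\<in>B. smooth_on (chart_map c ` (chart_dom c \<inter> V \<inter> F -` chart_dom d))
        (chart_map d \<circ> F \<circ> chart_inv c))"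

definition smooth_fun_on ::
  "('m::topological_space, 'e::euclidean_space) chart set \<Rightarrow> 'm set \<Rightarrow>
   ('m \<Rightarrow> 'f::real_normed_vector) \<Rightarrow> bool" where
  "smooth_fun_on A V f \<longleftrightarrow> open V \<and>
     (\<forall>c\<in>A. smooth_on (chart_map c ` (chart_dom c \<inter> V)) (f \<circ> chart_inv c))"


section \<open>Tangent vectors and tensor fields\<close>

instantiation "fun" :: (type, real_vector) real_vector
begin

definition scaleR_fun :: "real \<Rightarrow> ('a \<Rightarrow> 'b) \<Rightarrow> 'a \<Rightarrow> 'b" where
  "scaleR_fun r f = (\<lambda>x. r *\<^sub>R f x)"

instance
  by standard (auto simp: scaleR_fun_def fun_eq_iff scaleR_add_right scaleR_add_left)

end

text \<open>
  A tangent vector at \<open>p\<close> is the family of its coordinate vectors in all charts around \<open>p\<close>,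
  related by the differentials of the coordinate changes (and zero for all other charts).
\<close>

type_synonym ('m, 'e) tvec = "('m, 'e) chart \<Rightarrow> 'e"

definition tangent_space ::
  "('m, 'e::euclidean_space) chart set \<Rightarrow> 'm \<Rightarrow> ('m, 'e) tvec set" where
  "tangent_space A p = {v.
     (\<forall>c\<in>charts_at A p. \<forall>c'\<in>charts_at A p. v c' = dird (transition c c') (chart_map c p) (v c)) \<and>
     (\<forall>c. c \<notin> charts_at A p \<longrightarrow> v c = 0)}"

text \<open>The tangent vector at \<open>p\<close> with coordinate vector \<open>e\<close> in the chart \<open>c\<close>:\<close>

definition tvec_of ::
  "('m, 'e::euclidean_space) chart set \<Rightarrow> ('m, 'e) chart \<Rightarrow> 'm \<Rightarrow> 'e \<Rightarrow> ('m, 'e) tvec" where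
  "tvec_of A c p e =
     (\<lambda>c'. if c' \<in> charts_at A p then dird (transition c c') (chart_map c p) e else 0)"

definition tangent_map ::
  "('m, 'e::euclidean_space) chart set \<Rightarrow> ('b, 'f::euclidean_space) chart set \<Rightarrow> ('m \<Rightarrow> 'b) \<Rightarrow>
   'm \<Rightarrow> ('m, 'e) tvec \<Rightarrow> ('b, 'f) tvec" where
  "tangent_map A B F p v =
     (let c = (SOME c. c \<in> charts_at A p) in
      (\<lambda>d. if d \<in> charts_at B (F p)
           then frechet_derivative (chart_map d \<circ> F \<circ> chart_inv c) (at (chart_map c p)) (v c)
           else 0))"

text \<open>
  The fields below are only relevant on tangent vectors: \<open>\<eta> p\<close>, \<open>g p\<close> and \<open>\<phi> p\<close>
  act on \<open>tangent_space A p\<close>. Their coordinate expressions in a chart are: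
\<close>

type_synonym ('m, 'e) vfield = "'m \<Rightarrow> ('m, 'e) tvec"
type_synonym ('m, 'e) form1 = "'m \<Rightarrow> ('m, 'e) tvec \<Rightarrow> real"
type_synonym ('m, 'e) form2 = "'m \<Rightarrow> ('m, 'e) tvec \<Rightarrow> ('m, 'e) tvec \<Rightarrow> real"
type_synonym ('m, 'e) endo = "'m \<Rightarrow> ('m, 'e) tvec \<Rightarrow> ('m, 'e) tvec"

definition rep_vf :: "('m, 'e) chart \<Rightarrow> ('m, 'e) vfield \<Rightarrow> 'e \<Rightarrow> 'e" where
  "rep_vf c X x = X (chart_inv c x) c"

definition rep1 ::
  "('m, 'e::euclidean_space) chart set \<Rightarrow> ('m, 'e) chart \<Rightarrow> ('m, 'e) form1 \<Rightarrow> 'e \<Rightarrow> 'e \<Rightarrow> real" where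
  "rep1 A c \<eta> x u = \<eta> (chart_inv c x) (tvec_of A c (chart_inv c x) u)"

definition rep2 ::
  "('m, 'e::euclidean_space) chart set \<Rightarrow> ('m, 'e) chart \<Rightarrow> ('m, 'e) form2 \<Rightarrow>
   'e \<Rightarrow> 'e \<Rightarrow> 'e \<Rightarrow> real" where
  "rep2 A c g x u v =
     g (chart_inv c x) (tvec_of A c (chart_inv c x) u) (tvec_of A c (chart_inv c x) v)"

definition rep_endo ::
  "('m, 'e::euclidean_space) chart set \<Rightarrow> ('m, 'e) chart \<Rightarrow> ('m, 'e) endo \<Rightarrow> 'e \<Rightarrow> 'e \<Rightarrow> 'e" where
  "rep_endo A c \<phi> x u = \<phi> (chart_inv c x) (tvec_of A c (chart_inv c x) u) c"

definition linear_on_set :: "'v::real_vector set \<Rightarrow> ('v \<Rightarrow> 'w::real_vector) \<Rightarrow> bool" where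
  "linear_on_set S F \<longleftrightarrow>
     (\<forall>u\<in>S. \<forall>v\<in>S. \<forall>a b. F (a *\<^sub>R u + b *\<^sub>R v) = a *\<^sub>R F u + b *\<^sub>R F v)"

definition vector_field :: "('m, 'e::euclidean_space) chart set \<Rightarrow> ('m, 'e) vfield \<Rightarrow> bool" where
  "vector_field A X \<longleftrightarrow> (\<forall>p. X p \<in> tangent_space A p) \<and>
     (\<forall>c\<in>A. smooth_on (chart_ran c) (rep_vf c X))"

definition one_form :: "('m, 'e::euclidean_space) chart set \<Rightarrow> ('m, 'e) form1 \<Rightarrow> bool" where
  "one_form A \<eta> \<longleftrightarrow> (\<forall>p. linear_on_set (tangent_space A p) (\<eta> p)) \<and>
     (\<forall>c\<in>A. \<forall>u. smooth_on (chart_ran c) (\<lambda>x. rep1 A c \<eta> x u))"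

definition bilinear_field :: "('m, 'e::euclidean_space) chart set \<Rightarrow> ('m, 'e) form2 \<Rightarrow> bool" where
  "bilinear_field A g \<longleftrightarrow>
     (\<forall>p. \<forall>u\<in>tangent_space A p.
        linear_on_set (tangent_space A p) (g p u) \<and>
        linear_on_set (tangent_space A p) (\<lambda>v. g p v u)) \<and>
     (\<forall>c\<in>A. \<forall>u v. smooth_on (chart_ran c) (\<lambda>x. rep2 A c g x u v))"

definition endo_field :: "('m, 'e::euclidean_space) chart set \<Rightarrow> ('m, 'e) endo \<Rightarrow> bool" where
  "endo_field A \<phi> \<longleftrightarrow>
     (\<forall>p. \<phi> p ` tangent_space A p \<subseteq> tangent_space A p \<and>
          linear_on_set (tangent_space A p) (\<phi> p)) \<and>
     (\<forall>c\<in>A. \<forall>u. smooth_on (chart_ran c) (\<lambda>x. rep_endo A c \<phi> x u))"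

definition riemannian_metric :: "('m, 'e::euclidean_space) chart set \<Rightarrow> ('m, 'e) form2 \<Rightarrow> bool" where
  "riemannian_metric A g \<longleftrightarrow> bilinear_field A g \<and>
     (\<forall>p. \<forall>u\<in>tangent_space A p. \<forall>v\<in>tangent_space A p. g p u v = g p v u) \<and>
     (\<forall>p. \<forall>u\<in>tangent_space A p. u \<noteq> 0 \<longrightarrow> g p u u > 0)"


section \<open>Differential operators in coordinates\<close>

text \<open>
  These act on fields on an open subset of a Euclidean space. Tensorial expressions are
  evaluated on constant vectors, i.e. on coordinate fields, whose brackets vanish.
\<close>

definition vf_bracket :: "('e::euclidean_space \<Rightarrow> 'e) \<Rightarrow> ('e \<Rightarrow> 'e) \<Rightarrow> 'e \<Rightarrow> 'e" where
  "vf_bracket X Y x = dird Y x (X x) - dird X x (Y x)"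

text \<open>\<open>(L\<^sub>X \<phi>) Y = [X, \<phi> Y] - \<phi> [X, Y]\<close> for the constant field \<open>Y = u\<close>:\<close>

definition lie_endo :: "('e::euclidean_space \<Rightarrow> 'e) \<Rightarrow> ('e \<Rightarrow> 'e \<Rightarrow> 'e) \<Rightarrow> 'e \<Rightarrow> 'e \<Rightarrow> 'e" where
  "lie_endo X \<phi> x u = vf_bracket X (\<lambda>y. \<phi> y u) x - \<phi> x (vf_bracket X (\<lambda>_. u) x)"

text \<open>\<open>d\<eta>(X,Y) = (X \<eta>(Y) - Y \<eta>(X) - \<eta>([X,Y])) / 2\<close>, with the factor
  customary in contact metric geometry:\<close>

definition ext_d1 :: "('e::euclidean_space \<Rightarrow> 'e \<Rightarrow> real) \<Rightarrow> 'e \<Rightarrow> 'e \<Rightarrow> 'e \<Rightarrow> real" where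
  "ext_d1 \<eta> x u v = (1/2) * (dird (\<lambda>y. \<eta> y v) x u - dird (\<lambda>y. \<eta> y u) x v)"

text \<open>Up to a constant factor, which is irrelevant as it is only used for closedness:\<close>

definition ext_d2 :: "('e::euclidean_space \<Rightarrow> 'e \<Rightarrow> 'e \<Rightarrow> real) \<Rightarrow> 'e \<Rightarrow> 'e \<Rightarrow> 'e \<Rightarrow> 'e \<Rightarrow> real" where
  "ext_d2 \<omega> x u v w =
     dird (\<lambda>y. \<omega> y v w) x u + dird (\<lambda>y. \<omega> y w u) x v + dird (\<lambda>y. \<omega> y u v) x w"

text \<open>The Christoffel symbols of the metric \<open>G\<close> (Koszul formula on constant fields):\<close>

definition christoffel ::
  "('e::euclidean_space \<Rightarrow> 'e \<Rightarrow> 'e \<Rightarrow> real) \<Rightarrow> 'e \<Rightarrow> 'e \<Rightarrow> 'e \<Rightarrow> 'e" where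
  "christoffel G x u v = (THE w. \<forall>z. G x w z =
     (1/2) * (dird (\<lambda>y. G y v z) x u + dird (\<lambda>y. G y u z) x v - dird (\<lambda>y. G y u v) x z))"

definition levi_civita ::
  "('e::euclidean_space \<Rightarrow> 'e \<Rightarrow> 'e \<Rightarrow> real) \<Rightarrow> ('e \<Rightarrow> 'e) \<Rightarrow> ('e \<Rightarrow> 'e) \<Rightarrow> 'e \<Rightarrow> 'e" where
  "levi_civita G X Y x = dird Y x (X x) + christoffel G x (X x) (Y x)"

definition curvature ::
  "('e::euclidean_space \<Rightarrow> 'e \<Rightarrow> 'e \<Rightarrow> real) \<Rightarrow>
   ('e \<Rightarrow> 'e) \<Rightarrow> ('e \<Rightarrow> 'e) \<Rightarrow> ('e \<Rightarrow> 'e) \<Rightarrow> 'e \<Rightarrow> 'e" where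
  "curvature G X Y Z x =
     levi_civita G X (levi_civita G Y Z) x - levi_civita G Y (levi_civita G X Z) x
     - levi_civita G (vf_bracket X Y) Z x"

text \<open>
  The coordinate operators are natural under coordinate changes, so the relations between
  tensor fields below are imposed in every chart.
\<close>

definition is_ext_deriv ::
  "('m, 'e::euclidean_space) chart set \<Rightarrow> ('m, 'e) form1 \<Rightarrow> ('m, 'e) form2 \<Rightarrow> bool" where
  "is_ext_deriv A \<eta> \<Omega> \<longleftrightarrow>
     (\<forall>c\<in>A. \<forall>x\<in>chart_ran c. \<forall>u v. rep2 A c \<Omega> x u v = ext_d1 (rep1 A c \<eta>) x u v)"

definition closed_2form :: "('m, 'e::euclidean_space) chart set \<Rightarrow> ('m, 'e) form2 \<Rightarrow> bool" where
  "closed_2form A \<omega> \<longleftrightarrow> (\<forall>c\<in>A. \<forall>x\<in>chart_ran c. \<forall>u v w. ext_d2 (rep2 A c \<omega>) x u v w = 0)"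


section \<open>Contact metric manifolds\<close>

text \<open>
  \<open>\<eta> \<and> (d\<eta>)\<^sup>n \<noteq> 0\<close> at every point. The sum over permutations is, up to a
  nonzero constant, the value of this form on \<open>v 0, \<dots>, v (2n)\<close>.
\<close>

definition contact_form :: "('m, 'e::euclidean_space) chart set \<Rightarrow> nat \<Rightarrow> ('m, 'e) form1 \<Rightarrow> bool" where
  "contact_form A n \<eta> \<longleftrightarrow> one_form A \<eta> \<and>
     (\<forall>c\<in>A. \<forall>x\<in>chart_ran c. \<exists>v :: nat \<Rightarrow> 'e.
        (\<Sum>\<sigma> | \<sigma> permutes {..<2*n+1}. of_int (sign \<sigma>) * rep1 A c \<eta> x (v (\<sigma> 0)) *
           (\<Prod>i<n. ext_d1 (rep1 A c \<eta>) x (v (\<sigma> (2*i+1))) (v (\<sigma> (2*i+2))))) \<noteq> 0)"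

definition reeb_field ::
  "('m, 'e::euclidean_space) chart set \<Rightarrow> ('m, 'e) form1 \<Rightarrow> ('m, 'e) vfield \<Rightarrow> bool" where
  "reeb_field A \<eta> \<xi> \<longleftrightarrow> vector_field A \<xi> \<and> (\<forall>p. \<eta> p (\<xi> p) = 1) \<and>
     (\<forall>c\<in>A. \<forall>x\<in>chart_ran c. \<forall>v. ext_d1 (rep1 A c \<eta>) x (rep_vf c \<xi> x) v = 0)"

definition contact_metric_manifold ::
  "('m::{t2_space, second_countable_topology}, 'e::euclidean_space) chart set \<Rightarrow> nat \<Rightarrow>
   ('m, 'e) form1 \<Rightarrow> ('m, 'e) vfield \<Rightarrow> ('m, 'e) form2 \<Rightarrow> ('m, 'e) endo \<Rightarrow> bool" where
  "contact_metric_manifold A n \<eta> \<xi> g \<phi> \<longleftrightarrow>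
     smooth_structure A \<and> DIM('e) = 2 * n + 1 \<and>
     contact_form A n \<eta> \<and> reeb_field A \<eta> \<xi> \<and> riemannian_metric A g \<and> endo_field A \<phi> \<and>
     (\<forall>p. \<forall>v\<in>tangent_space A p. \<eta> p v = g p (\<xi> p) v) \<and>
     (\<forall>p. \<forall>v\<in>tangent_space A p. \<phi> p (\<phi> p v) = - v + \<eta> p v *\<^sub>R \<xi> p) \<and>
     is_ext_deriv A \<eta> (\<lambda>p u v. g p u (\<phi> p v))"

text \<open>\<open>h = (1/2) L\<^sub>\<xi> \<phi>\<close>:\<close>

definition is_contact_h ::
  "('m, 'e::euclidean_space) chart set \<Rightarrow> ('m, 'e) vfield \<Rightarrow> ('m, 'e) endo \<Rightarrow> ('m, 'e) endo \<Rightarrow> bool" where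
  "is_contact_h A \<xi> \<phi> h \<longleftrightarrow> endo_field A h \<and>
     (\<forall>c\<in>A. \<forall>x\<in>chart_ran c. \<forall>u.
        rep_endo A c h x u = (1/2) *\<^sub>R lie_endo (rep_vf c \<xi>) (rep_endo A c \<phi>) x u)"

definition kappa_mu_manifold ::
  "('m::{t2_space, second_countable_topology}, 'e::euclidean_space) chart set \<Rightarrow> nat \<Rightarrow>
   ('m, 'e) form1 \<Rightarrow> ('m, 'e) vfield \<Rightarrow> ('m, 'e) form2 \<Rightarrow> ('m, 'e) endo \<Rightarrow> ('m, 'e) endo \<Rightarrow>
   real \<Rightarrow> real \<Rightarrow> bool" where
  "kappa_mu_manifold A n \<eta> \<xi> g \<phi> h \<kappa> \<mu> \<longleftrightarrow>
     contact_metric_manifold A n \<eta> \<xi> g \<phi> \<and> is_contact_h A \<xi> \<phi> h \<and>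
     (\<forall>c\<in>A. \<forall>x\<in>chart_ran c. \<forall>u v.
        curvature (rep2 A c g) (\<lambda>_. u) (\<lambda>_. v) (rep_vf c \<xi>) x =
          \<kappa> *\<^sub>R (rep1 A c \<eta> x v *\<^sub>R u - rep1 A c \<eta> x u *\<^sub>R v) +
          \<mu> *\<^sub>R (rep1 A c \<eta> x v *\<^sub>R rep_endo A c h x u - rep1 A c \<eta> x u *\<^sub>R rep_endo A c h x v))"

definition non_sasakian :: "real \<Rightarrow> bool" where
  "non_sasakian \<kappa> \<longleftrightarrow> \<kappa> < 1"

definition boeckx_index :: "real \<Rightarrow> real \<Rightarrow> real" where
  "boeckx_index \<kappa> \<mu> = (1 - \<mu> / 2) / sqrt (1 - \<kappa>)"

definition ker_form ::
  "('m, 'e::euclidean_space) chart set \<Rightarrow> ('m, 'e) form1 \<Rightarrow> 'm \<Rightarrow> ('m, 'e) tvec set" where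
  "ker_form A \<eta> p = {v \<in> tangent_space A p. \<eta> p v = 0}"

definition eigenspace_on :: "'v::real_vector set \<Rightarrow> ('v \<Rightarrow> 'v) \<Rightarrow> real \<Rightarrow> 'v set" where
  "eigenspace_on S F a = {v \<in> S. F v = a *\<^sub>R v}"

definition eigenvalues_on :: "'v::real_vector set \<Rightarrow> ('v \<Rightarrow> 'v) \<Rightarrow> real set" where
  "eigenvalues_on S F = {a. \<exists>v\<in>S. v \<noteq> 0 \<and> F v = a *\<^sub>R v}"


section \<open>The Boothby-Wang fibration\<close>

definition symplectic_form :: "('m, 'e::euclidean_space) chart set \<Rightarrow> ('m, 'e) form2 \<Rightarrow> bool" where
  "symplectic_form A \<omega> \<longleftrightarrow> bilinear_field A \<omega> \<and>
     (\<forall>p. \<forall>u\<in>tangent_space A p. \<forall>v\<in>tangent_space A p. \<omega> p u v = - \<omega> p v u) \<and>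
     (\<forall>p. \<forall>u\<in>tangent_space A p. (\<forall>v\<in>tangent_space A p. \<omega> p u v = 0) \<longrightarrow> u = 0) \<and>
     closed_2form A \<omega>"

definition pullback2 ::
  "('m, 'e::euclidean_space) chart set \<Rightarrow> ('b, 'f::euclidean_space) chart set \<Rightarrow> ('m \<Rightarrow> 'b) \<Rightarrow>
   ('b, 'f) form2 \<Rightarrow> ('m, 'e) form2" where
  "pullback2 A B F \<omega> = (\<lambda>p u v. \<omega> (F p) (tangent_map A B F p u) (tangent_map A B F p v))"

definition is_flow ::
  "('m::topological_space, 'e::euclidean_space) chart set \<Rightarrow> ('m, 'e) vfield \<Rightarrow>
   (real \<Rightarrow> 'm \<Rightarrow> 'm) \<Rightarrow> bool" where
  "is_flow A \<xi> \<theta> \<longleftrightarrow>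
     (\<forall>p. \<theta> 0 p = p) \<and> (\<forall>s t p. \<theta> (s + t) p = \<theta> s (\<theta> t p)) \<and>
     (\<forall>p. continuous_on UNIV (\<lambda>t. \<theta> t p)) \<and>
     (\<forall>p t. \<forall>c\<in>charts_at A (\<theta> t p).
        ((\<lambda>s. chart_map c (\<theta> s p)) has_vector_derivative \<xi> (\<theta> t p) c) (at t))"

text \<open>
  Regularity: every point has a cubical coordinate neighbourhood in which \<open>\<xi>\<close> is
  a coordinate field and which every orbit meets in at most one coordinate line segment.
\<close>

definition regular_field ::
  "('m::topological_space, 'e::euclidean_space) chart set \<Rightarrow> ('m, 'e) vfield \<Rightarrow>
   (real \<Rightarrow> 'm \<Rightarrow> 'm) \<Rightarrow> bool" where
  "regular_field A \<xi> \<theta> \<longleftrightarrow>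
     (\<forall>p. \<exists>c\<in>charts_at A p. \<exists>a>0. \<exists>i\<in>Basis.
        chart_map c p = 0 \<and> chart_ran c = box (- (a *\<^sub>R One)) (a *\<^sub>R One) \<and>
        (\<forall>q\<in>chart_dom c. \<xi> q c = i) \<and>
        (\<forall>q\<in>chart_dom c. \<forall>t. \<theta> t q \<in> chart_dom c \<longrightarrow>
           chart_map c (\<theta> t q) - chart_map c q \<in> span {i}))"

text \<open>
  The circle is \<open>\<real> / \<tau>\<int>\<close>. The last condition is local triviality: \<open>x \<mapsto> (\<pi> x, a x)\<close>
  is an equivariant trivialisation over \<open>V\<close> with inverse \<open>(v, cis (2\<pi>t/\<tau>)) \<mapsto> \<theta> t (s v)\<close>.
\<close>

definition principal_circle_bundle ::
  "('m::topological_space, 'e::euclidean_space) chart set \<Rightarrow>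
   ('b::topological_space, 'f::euclidean_space) chart set \<Rightarrow>
   (real \<Rightarrow> 'm \<Rightarrow> 'm) \<Rightarrow> real \<Rightarrow> ('m \<Rightarrow> 'b) \<Rightarrow> bool" where
  "principal_circle_bundle A B \<theta> \<tau> \<pi> \<longleftrightarrow>
     \<tau> > 0 \<and> (\<forall>p t. \<theta> t p = p \<longleftrightarrow> (\<exists>k::int. t = of_int k * \<tau>)) \<and>
     smooth_map_on A B UNIV \<pi> \<and> surj \<pi> \<and>
     (\<forall>p q. \<pi> p = \<pi> q \<longleftrightarrow> (\<exists>t. q = \<theta> t p)) \<and>
     (\<forall>b. \<exists>V s. \<exists>a :: 'm \<Rightarrow> complex. b \<in> V \<and> smooth_map_on B A V s \<and>
        smooth_fun_on A (\<pi> -` V) a \<and>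
        (\<forall>p\<in>\<pi> -` V. cmod (a p) = 1 \<and> (\<forall>t. a (\<theta> t p) = cis (2 * pi * t / \<tau>) * a p)) \<and>
        (\<forall>v\<in>V. \<pi> (s v) = v \<and> a (s v) = 1))"

definition boothby_wang ::
  "('m::{t2_space, second_countable_topology}, 'e::euclidean_space) chart set \<Rightarrow>
   ('b::{t2_space, second_countable_topology}, 'f::euclidean_space) chart set \<Rightarrow> nat \<Rightarrow>
   ('m, 'e) form1 \<Rightarrow> (real \<Rightarrow> 'm \<Rightarrow> 'm) \<Rightarrow> ('m \<Rightarrow> 'b) \<Rightarrow> ('b, 'f) form2 \<Rightarrow> bool" where
  "boothby_wang A B n \<eta> \<theta> \<pi> \<omega> \<longleftrightarrow>
     smooth_structure B \<and> DIM('f) = 2 * n \<and>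
     (\<exists>\<tau>. principal_circle_bundle A B \<theta> \<tau> \<pi>) \<and>
     symplectic_form B \<omega> \<and> is_ext_deriv A \<eta> (pullback2 A B \<pi> \<omega>)"


section \<open>Solutions of the error tensor equation\<close>

definition almost_complex_structure ::
  "('m, 'e::euclidean_space) chart set \<Rightarrow> ('m, 'e) endo \<Rightarrow> bool" where
  "almost_complex_structure A J \<longleftrightarrow> endo_field A J \<and>
     (\<forall>p. \<forall>v\<in>tangent_space A p. J p (J p v) = - v)"

definition associated_metric ::
  "('m, 'e::euclidean_space) chart set \<Rightarrow> ('m, 'e) form2 \<Rightarrow> ('m, 'e) form2 \<Rightarrow> bool" where
  "associated_metric A \<omega> g \<longleftrightarrow> riemannian_metric A g \<and>
     (\<exists>J. almost_complex_structure A J \<and>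
        (\<forall>p. \<forall>u\<in>tangent_space A p. \<forall>v\<in>tangent_space A p. g p u (J p v) = \<omega> p u v))"

text \<open>
  A \<open>(1,1)\<close>-tensor field on \<open>ker \<eta>\<close>; smoothness is that of its composition
  with the projection onto \<open>ker \<eta>\<close> along \<open>\<xi>\<close>. Values off \<open>ker \<eta>\<close> are irrelevant.
\<close>

definition ker_endo_field ::
  "('m, 'e::euclidean_space) chart set \<Rightarrow> ('m, 'e) form1 \<Rightarrow> ('m, 'e) vfield \<Rightarrow> ('m, 'e) endo \<Rightarrow> bool" where
  "ker_endo_field A \<eta> \<xi> T \<longleftrightarrow>
     (\<forall>p. T p ` ker_form A \<eta> p \<subseteq> ker_form A \<eta> p) \<and>
     endo_field A (\<lambda>p v. T p (v - \<eta> p v *\<^sub>R \<xi> p))"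

definition error_solution ::
  "('m::topological_space, 'e::euclidean_space) chart set \<Rightarrow> ('b, 'f::euclidean_space) chart set \<Rightarrow>
   ('m, 'e) form1 \<Rightarrow> ('m, 'e) vfield \<Rightarrow> ('m, 'e) form2 \<Rightarrow> ('m \<Rightarrow> 'b) \<Rightarrow> ('b, 'f) form2 \<Rightarrow>
   ('m, 'e) endo \<Rightarrow> ('m \<Rightarrow> real) \<Rightarrow> ('b, 'f) form2 \<Rightarrow> bool" where
  "error_solution A B \<eta> \<xi> g\<^sub>M \<pi> \<omega> T f g \<longleftrightarrow>
     ker_endo_field A \<eta> \<xi> T \<and> smooth_fun_on A UNIV f \<and> associated_metric B \<omega> g \<and>
     (\<forall>p. \<forall>X\<in>ker_form A \<eta> p. \<forall>Y\<in>ker_form A \<eta> p.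
        g\<^sub>M p (T p X) Y =
          g\<^sub>M p X Y - exp (2 * f p) * g (\<pi> p) (tangent_map A B \<pi> p X) (tangent_map A B \<pi> p Y))"

definition commute_on_ker ::
  "('m, 'e::euclidean_space) chart set \<Rightarrow> ('m, 'e) form1 \<Rightarrow> ('m, 'e) endo \<Rightarrow> ('m, 'e) endo \<Rightarrow> bool" where
  "commute_on_ker A \<eta> h T \<longleftrightarrow> (\<forall>p. \<forall>X\<in>ker_form A \<eta> p. h p (T p X) = T p (h p X))"

end

theory Submission
  imports Defs
begin

text \<open>
  Regularity provides charts in which \<open>\<xi>\<close> is a constant field \<open>e\<^sub>0\<close>, so that the Lie derivative
  along \<open>\<xi>\<close> is the directional derivative of coefficients. There \<open>\<nabla>\<^sub>v \<xi> = - \<phi>v + h\<phi>v\<close>, and evaluating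
  \<open>R(v, \<xi>)\<xi>\<close> yields, on \<open>ker \<eta>\<close> and with \<open>\<lambda> = sqrt (1 - \<kappa>)\<close> and \<open>a = 2 - \<mu>\<close>, both
  \<open>h\<^sup>2 = \<lambda>\<^sup>2\<close> and \<open>L\<^sub>\<xi> h = (2\<lambda>\<^sup>2 - a h)\<phi>\<close>.

  Let \<open>s = e\<^sup>-\<^sup>2\<^sup>f (I - T)\<close> and let \<open>\<psi>\<close> be the lift to \<open>ker \<eta>\<close> of the almost complex structure of the
  solution, so that \<open>s \<psi> = \<phi>\<close> and \<open>s = - \<phi>\<psi>\<close>. As \<open>s\<close> commutes with \<open>h\<close>, \<open>\<psi>\<close> anticommutes
  with \<open>h\<close>; since \<open>\<psi>\<close> is invariant under the flow of \<open>\<xi>\<close>, it also anticommutes with \<open>L\<^sub>\<xi> h\<close>.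
  This gives \<open>(a h - 2\<lambda>\<^sup>2) s\<^sup>2 = a h + 2\<lambda>\<^sup>2\<close>, that is, \<open>(a - 2\<lambda>) s\<^sup>2 = a + 2\<lambda>\<close> on the
  \<open>\<lambda>\<close>-eigenspace of \<open>h\<close> and \<open>(a + 2\<lambda>) s\<^sup>2 = a - 2\<lambda>\<close> on the other one. Positivity of \<open>s\<close> then
  forces \<open>\<bar>a\<bar> > 2\<lambda>\<close>, which is the claim on the Boeckx index, and determines \<open>s\<close> as the positive
  square root. Hence \<open>T\<close> is determined by \<open>f\<close>, and \<open>g(d\<pi>\<cdot>, d\<pi>\<cdot>) = g\<^sub>M(s\<cdot>, \<cdot>)\<close> determines \<open>g\<close>.
\<close>

section \<open>Coordinates on manifolds\<close>

lemma smooth_on_differentiable: "smooth_on S f \<Longrightarrow> x \<in> S \<Longrightarrow> f differentiable (at x)"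
proof -
  assume "smooth_on S f" "x \<in> S"
  then have "Ck_on (Suc 0) S f" unfolding smooth_on_def by blast
  with \<open>x \<in> S\<close> show ?thesis by simp
qed

lemma dird_has_derivative:
  "f differentiable (at x) \<Longrightarrow> (f has_derivative dird f x) (at x)"
  by (simp add: frechet_derivative_works)

lemma dird_eqI: "(f has_derivative D) (at x) \<Longrightarrow> dird f x v = D v"
  by (simp add: frechet_derivative_at[symmetric])

text \<open>Both functions have the same derivatives at \<open>x\<close>, possibly none, so the
  choice made by \<open>frechet_derivative\<close> is the same for both.\<close>

lemma dird_cong:
  assumes "open S" "x \<in> S" "\<And>y. y \<in> S \<Longrightarrow> f y = g y"
  shows "dird f x v = dird g x v"
proof -
  have "(f has_derivative D) (at x) \<longleftrightarrow> (g has_derivative D) (at x)" for D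
    using has_derivative_transform_within_open[OF _ assms(1,2), of f D UNIV g]
      has_derivative_transform_within_open[OF _ assms(1,2), of g D UNIV f] assms(3) by auto
  then show ?thesis by (simp add: frechet_derivative_def)
qed

lemma differentiable_cong:
  assumes "open S" "x \<in> S" "\<And>y. y \<in> S \<Longrightarrow> f y = g y" "g differentiable (at x)"
  shows "f differentiable (at x)"
proof -
  from assms(4) obtain D where "(g has_derivative D) (at x)" unfolding differentiable_def by blast
  then have "(f has_derivative D) (at x)"
    by (rule has_derivative_transform_within_open[OF _ assms(1,2)]) (simp add: assms(3))
  then show ?thesis unfolding differentiable_def by blast
qed

lemma dird_comp:
  assumes "f differentiable (at x)" "g differentiable (at (f x))"
  shows "dird (g \<circ> f) x v = dird g (f x) (dird f x v)"
  using diff_chain_at[OF dird_has_derivative dird_has_derivative, OF assms]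
  by (simp add: dird_eqI)

lemma linear_dird: "f differentiable (at x) \<Longrightarrow> linear (dird f x)"
  by (rule linear_frechet_derivative)

lemma dird_id_near:
  assumes "open S" "x \<in> S" "\<And>y. y \<in> S \<Longrightarrow> f y = y"
  shows "dird f x v = v"
proof -
  have "dird f x v = dird (\<lambda>y. y) x v" by (rule dird_cong[OF assms])
  also have "\<dots> = v" by (rule dird_eqI[OF has_derivative_ident])
  finally show ?thesis .
qed

lemma dird_const_near:
  assumes "open S" "x \<in> S" "\<And>y. y \<in> S \<Longrightarrow> f y = k"
  shows "dird f x v = 0"
proof -
  have "dird f x v = dird (\<lambda>y. k) x v" by (rule dird_cong[OF assms])
  also have "\<dots> = 0" by (rule dird_eqI[OF has_derivative_const])
  finally show ?thesis .
qed

section \<open>Charts, coordinate changes and tangent vectors\<close>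

lemma chart_inv_map:
  assumes "is_chart c" "p \<in> chart_dom c" shows "chart_inv c (chart_map c p) = p"
  using assms unfolding is_chart_def homeomorphism_def by blast

lemma chart_inv_in:
  assumes "is_chart c" "x \<in> chart_ran c" shows "chart_inv c x \<in> chart_dom c"
  using assms unfolding is_chart_def homeomorphism_def by blast

lemma chart_map_inv:
  assumes "is_chart c" "x \<in> chart_ran c" shows "chart_map c (chart_inv c x) = x"
  using assms unfolding is_chart_def homeomorphism_def by blast

lemma chart_map_in: "p \<in> chart_dom c \<Longrightarrow> chart_map c p \<in> chart_ran c"
  by (simp add: chart_ran_def)

text \<open>Seen as a preimage under the continuous inverse chart, the image of a chart overlap is
  open, so derivatives at its points may be computed there.\<close>

lemma chart_image_eq:
  assumes "is_chart c"
  shows "chart_map c ` (chart_dom c \<inter> U) = chart_ran c \<inter> chart_inv c -` U"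
proof -
  have "x \<in> chart_map c ` (chart_dom c \<inter> U)" if "x \<in> chart_ran c" "chart_inv c x \<in> U" for x
    using that chart_inv_in[OF assms] chart_map_inv[OF assms] by (intro image_eqI[of _ _ "chart_inv c x"]) auto
  then show ?thesis using assms by (auto simp: chart_inv_map chart_map_in)
qed

lemma open_chart_image:
  assumes "is_chart c" "open U"
  shows "open (chart_map c ` (chart_dom c \<inter> U))"
  unfolding chart_image_eq[OF assms(1)]
  using assms by (intro continuous_open_preimage) (auto simp: is_chart_def homeomorphism_def)

context
  fixes A :: "('m::{t2_space, second_countable_topology}, 'e::euclidean_space) chart set"
  assumes A: "smooth_structure A"
begin

lemma atlas_chart: "c \<in> A \<Longrightarrow> is_chart c"
  using A by (simp add: smooth_structure_def)

lemma charts_atD: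
  assumes "c \<in> charts_at A p"
  shows "c \<in> A" "p \<in> chart_dom c" "is_chart c"
  using assms atlas_chart by (auto simp: charts_at_def)

lemma charts_at_nonempty: "\<exists>c. c \<in> charts_at A p"
proof -
  have "p \<in> (\<Union>c\<in>A. chart_dom c)" using A by (simp add: smooth_structure_def)
  then show ?thesis by (auto simp: charts_at_def)
qed

lemma transition_differentiable:
  assumes "c \<in> charts_at A p" "c' \<in> charts_at A p"
  shows "transition c c' differentiable (at (chart_map c p))"
proof -
  have "compatible c c'"
    using A charts_atD(1)[OF assms(1)] charts_atD(1)[OF assms(2)]
    unfolding smooth_structure_def by blast
  then show ?thesis
    using assms by (auto simp: compatible_def charts_at_def intro!: smooth_on_differentiable)
qed

text \<open>On the overlap, \<open>F\<close> read in \<open>c\<close> is \<open>F\<close> read in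
  \<open>c'\<close> after the transition map. With \<open>F\<close> a third coordinate map this is
  the cocycle rule below; with \<open>F\<close> a map followed by a chart of its target it frees
  \<open>tangent_map\<close> from its arbitrary source chart.\<close>

lemma dird_change_chart:
  fixes F :: "'m \<Rightarrow> 'k::real_normed_vector"
  assumes c: "c \<in> charts_at A p" "c' \<in> charts_at A p"
    and F: "(F \<circ> chart_inv c') differentiable (at (chart_map c' p))"
  shows "dird (F \<circ> chart_inv c) (chart_map c p) v =
    dird (F \<circ> chart_inv c') (chart_map c' p) (dird (transition c c') (chart_map c p) v)"
proof -
  let ?S = "chart_map c ` (chart_dom c \<inter> chart_dom c')"
  note C = charts_atD[OF c(1)] charts_atD[OF c(2)]
  have S: "open ?S" using C by (intro open_chart_image) (auto simp: is_chart_def)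
  have tr: "transition c c' (chart_map c p) = chart_map c' p"
    using C by (simp add: transition_def chart_inv_map)
  have "dird (F \<circ> chart_inv c) (chart_map c p) v =
    dird ((F \<circ> chart_inv c') \<circ> transition c c') (chart_map c p) v"
    using C by (intro dird_cong[OF S]) (auto simp: transition_def chart_inv_map)
  also have "\<dots> = dird (F \<circ> chart_inv c') (chart_map c' p) (dird (transition c c') (chart_map c p) v)"
    using F transition_differentiable[OF c] by (subst dird_comp) (auto simp: tr)
  finally show ?thesis .
qed

lemma transition_cocycle:
  assumes c: "c \<in> charts_at A p" "c' \<in> charts_at A p" "c'' \<in> charts_at A p"
  shows "dird (transition c c'') (chart_map c p) v =
    dird (transition c' c'') (chart_map c' p) (dird (transition c c') (chart_map c p) v)"
  using dird_change_chart[OF c(1,2), of "chart_map c''"] transition_differentiable[OF c(2,3)]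
  by (simp add: transition_def)

lemma transition_self:
  assumes c: "c \<in> charts_at A p"
  shows "dird (transition c c) (chart_map c p) v = v"
proof (rule dird_id_near)
  show "open (chart_ran c)" using charts_atD(3)[OF c] by (simp add: is_chart_def)
  show "chart_map c p \<in> chart_ran c" by (rule chart_map_in[OF charts_atD(2)[OF c]])
  show "transition c c y = y" if "y \<in> chart_ran c" for y
    using chart_map_inv[OF charts_atD(3)[OF c] that] by (simp add: transition_def)
qed

text \<open>The compatibility demanded by \<open>tangent_space\<close> is the cocycle rule for the
  family generated by \<open>e\<close>.\<close>

lemma tvec_of_in: "c \<in> charts_at A p \<Longrightarrow> tvec_of A c p e \<in> tangent_space A p"
  unfolding tangent_space_def tvec_of_def
  by (simp cong: if_cong) (blast intro: transition_cocycle)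

lemma tvec_of_self [simp]: "c \<in> charts_at A p \<Longrightarrow> tvec_of A c p e c = e"
  by (simp add: tvec_of_def transition_self)

lemma tangent_spaceD:
  assumes "v \<in> tangent_space A p"
  shows "c \<in> charts_at A p \<Longrightarrow> c' \<in> charts_at A p \<Longrightarrow>
      dird (transition c c') (chart_map c p) (v c) = v c'"
    and "c \<notin> charts_at A p \<Longrightarrow> v c = 0"
  using assms unfolding tangent_space_def by (blast intro: sym)+

lemma tvec_of_coord: "c \<in> charts_at A p \<Longrightarrow> v \<in> tangent_space A p \<Longrightarrow> tvec_of A c p (v c) = v"
  unfolding tvec_of_def by (rule ext) (simp add: tangent_spaceD)

lemma tvec_eqI:
  "c \<in> charts_at A p \<Longrightarrow> v \<in> tangent_space A p \<Longrightarrow> w \<in> tangent_space A p \<Longrightarrow> v c = w c \<Longrightarrow> v = w"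
  by (rule box_equals[OF _ tvec_of_coord tvec_of_coord]) auto

lemma linear_transition: "c \<in> charts_at A p \<Longrightarrow> c' \<in> charts_at A p \<Longrightarrow> linear (dird (transition c c') (chart_map c p))"
  by (intro linear_dird transition_differentiable)

lemma tvec_of_lin:
  assumes "c \<in> charts_at A p"
  shows "tvec_of A c p (a *\<^sub>R u + b *\<^sub>R v) = a *\<^sub>R tvec_of A c p u + b *\<^sub>R tvec_of A c p v"
  using linear_transition[OF assms]
  by (auto simp: tvec_of_def fun_eq_iff scaleR_fun_def linear_add linear_scale)

lemma tangent_space_lin:
  assumes "u \<in> tangent_space A p" "v \<in> tangent_space A p"
  shows "a *\<^sub>R u + b *\<^sub>R v \<in> tangent_space A p"
proof -
  obtain c where c: "c \<in> charts_at A p" using charts_at_nonempty by blast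
  then have "a *\<^sub>R u + b *\<^sub>R v = tvec_of A c p (a *\<^sub>R u c + b *\<^sub>R v c)"
    using assms by (simp add: tvec_of_lin tvec_of_coord)
  then show ?thesis using tvec_of_in[OF c] by simp
qed

end

text \<open>\<open>tangent_map\<close> reads the vector in a chart obtained by choice. Changing the
  source chart by \<open>dird_change_chart\<close> and the target chart by the chain rule leads to
  the coordinate expression in any prescribed pair \<open>c\<close>, \<open>d\<close>.\<close>

lemma tangent_map_in_charts:
  fixes A :: "('m::{t2_space, second_countable_topology}, 'e::euclidean_space) chart set"
    and B :: "('b::{t2_space, second_countable_topology}, 'f::euclidean_space) chart set"
  assumes A: "smooth_structure A" and B: "smooth_structure B"
    and F: "smooth_map_on A B UNIV F"
    and c: "c \<in> charts_at A p" and d: "d \<in> charts_at B (F p)" and v: "v \<in> tangent_space A p"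
  shows "(chart_map d \<circ> F \<circ> chart_inv c) differentiable (at (chart_map c p))" (is ?D)
    and "tangent_map A B F p v =
      tvec_of B d (F p) (dird (chart_map d \<circ> F \<circ> chart_inv c) (chart_map c p) (v c))" (is ?E)
proof -
  have diff: "(chart_map d \<circ> F \<circ> chart_inv c) differentiable (at (chart_map c p))"
    if "c \<in> charts_at A p" "d \<in> charts_at B (F p)" for c d
    using F that unfolding smooth_map_on_def charts_at_def
    by (auto intro!: smooth_on_differentiable)
  show ?D by (rule diff[OF c d])
  define c0 where "c0 = (SOME c. c \<in> charts_at A p)"
  have c0: "c0 \<in> charts_at A p" unfolding c0_def using c by (rule someI)
  have "tangent_map A B F p v d' = tvec_of B d (F p) (dird (chart_map d \<circ> F \<circ> chart_inv c) (chart_map c p) (v c)) d'" for d'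
  proof (cases "d' \<in> charts_at B (F p)")
    case True
    note C = charts_atD[OF A c] and Dd = charts_atD[OF B d] and Dd' = charts_atD[OF B True]
    have v0: "v c0 = dird (transition c c0) (chart_map c p) (v c)"
      using tangent_spaceD(1)[OF A v c c0] by simp
    have "tangent_map A B F p v d' = dird (chart_map d' \<circ> F \<circ> chart_inv c0) (chart_map c0 p) (v c0)"
      using True by (simp add: tangent_map_def Let_def c0_def)
    also have "\<dots> = dird ((chart_map d' \<circ> F) \<circ> chart_inv c) (chart_map c p) (v c)"
      unfolding v0 using diff[OF c0 True]
      by (intro dird_change_chart[OF A c c0, symmetric]) (simp add: comp_assoc)
    also have "\<dots> = dird (transition d d' \<circ> (chart_map d \<circ> F \<circ> chart_inv c)) (chart_map c p) (v c)"
    proof (rule dird_cong)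
      \<comment> \<open>Factoring through \<open>d\<close> is legitimate only where \<open>F\<close>
        lands in its domain, which is an open set around \<open>p\<close>.\<close>
      have "open (F -` chart_dom d)"
        using F Dd unfolding smooth_map_on_def is_chart_def
        by (auto simp: continuous_on_open_vimage)
      then show "open (chart_map c ` (chart_dom c \<inter> F -` chart_dom d))"
        by (intro open_chart_image C)
    qed (use C Dd Dd' in \<open>auto simp: transition_def chart_inv_map\<close>)
    also have "\<dots> = dird (transition d d') (chart_map d (F p)) (dird (chart_map d \<circ> F \<circ> chart_inv c) (chart_map c p) (v c))"
      using C diff[OF c d] transition_differentiable[OF B d True]
      by (subst dird_comp) (auto simp: chart_inv_map)
    finally show ?thesis using True by (simp add: tvec_of_def)
  qed (simp add: tangent_map_def tvec_of_def Let_def)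
  then show ?E by blast
qed

lemma linear_on_setD:
  assumes "linear_on_set V F" "u \<in> V" "v \<in> V"
  shows "F (a *\<^sub>R u + b *\<^sub>R v) = a *\<^sub>R F u + b *\<^sub>R F v"
  using assms unfolding linear_on_set_def by blast

lemma linear_on_set_tvec_of:
  assumes A: "smooth_structure A" and c: "c \<in> charts_at A p"
    and F: "linear_on_set (tangent_space A p) F"
  shows "linear (\<lambda>u. F (tvec_of A c p u))"
proof (rule linearI)
  note * = linear_on_setD[OF F tvec_of_in[OF A c] tvec_of_in[OF A c], folded tvec_of_lin[OF A c]]
  show "F (tvec_of A c p (u + v)) = F (tvec_of A c p u) + F (tvec_of A c p v)" for u v
    using *[of 1 u 1 v] by simp
  show "F (tvec_of A c p (r *\<^sub>R u)) = r *\<^sub>R F (tvec_of A c p u)" for r u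
    using *[of r u 0 u] by simp
qed

lemma linear_eval: "linear F \<Longrightarrow> linear (\<lambda>u. F u c)" for F :: "'v::real_vector \<Rightarrow> 'a \<Rightarrow> 'w::real_vector"
  by (simp add: linear_iff scaleR_fun_def)

text \<open>This passes from finite to infinitesimal invariance along the flow, which is translation
  in an adapted chart.\<close>

lemma dird_zero_if_constant_on_line:
  fixes F :: "'e::euclidean_space \<Rightarrow> real"
  assumes F: "F differentiable (at y)" and \<epsilon>: "\<epsilon> > 0"
    and const: "\<And>t. \<bar>t\<bar> < \<epsilon> \<Longrightarrow> F (y + t *\<^sub>R e) = F y"
  shows "dird F y e = 0"
proof -
  have "((\<lambda>t. y + t *\<^sub>R e) has_derivative (\<lambda>t. t *\<^sub>R e)) (at 0)"
    by (auto intro!: derivative_eq_intros)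
  moreover have "(F has_derivative dird F y) (at (y + 0 *\<^sub>R e))"
    using dird_has_derivative[OF F] by simp
  ultimately have "((\<lambda>t. F (y + t *\<^sub>R e)) has_derivative (\<lambda>t. dird F y (t *\<^sub>R e))) (at 0)"
    by (rule has_derivative_compose)
  then have "((\<lambda>t. F (y + t *\<^sub>R e)) has_vector_derivative dird F y e) (at 0)"
    by (simp add: has_vector_derivative_def linear_scale[OF linear_dird[OF F]])
  moreover have "((\<lambda>t. F (y + t *\<^sub>R e)) has_vector_derivative 0) (at 0)"
    by (rule has_vector_derivative_transform_within_open
        [OF has_vector_derivative_const, where S = "{-\<epsilon><..<\<epsilon>}"])
      (use \<epsilon> const in \<open>auto simp: abs_less_iff\<close>)
  ultimately show ?thesis by (rule vector_derivative_unique_at)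
qed

section \<open>Contact metric structures in a chart with constant Reeb field\<close>

text \<open>The product rule for a field of linear maps applied to a moving vector. Expanding the
  vector in \<open>Basis\<close> leaves the finitely many functions \<open>H y b\<close>, so
  differentiability on fixed vectors suffices.\<close>

lemma dird_apply:
  fixes H :: "'a::euclidean_space \<Rightarrow> 'b::euclidean_space \<Rightarrow> 'c::real_normed_vector"
  assumes S: "open S" "x \<in> S" and lin: "\<And>y. y \<in> S \<Longrightarrow> linear (H y)"
    and H: "\<And>b. (\<lambda>y. H y b) differentiable (at x)" and w: "w differentiable (at x)"
  shows "(\<lambda>y. H y (w y)) differentiable (at x)"
    and "dird (\<lambda>y. H y (w y)) x v = dird (\<lambda>y. H y (w x)) x v + H x (dird w x v)"
proof -
  let ?D = "\<lambda>w dw v. \<Sum>b\<in>Basis. (w \<bullet> b) *\<^sub>R dird (\<lambda>y. H y b) x v + (dw v \<bullet> b) *\<^sub>R H x b"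
  have exp: "H y a = (\<Sum>b\<in>Basis. (a \<bullet> b) *\<^sub>R H y b)" if "y \<in> S" for y a
  proof -
    have "H y a = H y (\<Sum>b\<in>Basis. (a \<bullet> b) *\<^sub>R b)" by (simp add: euclidean_representation)
    then show ?thesis using lin[OF that] by (simp add: linear_sum linear_scale)
  qed
  have key: "((\<lambda>y. H y (w y)) has_derivative ?D (w x) dw) (at x)"
    if w: "(w has_derivative dw) (at x)" for w dw
  proof -
    have "((\<lambda>y. \<Sum>b\<in>Basis. (w y \<bullet> b) *\<^sub>R H y b) has_derivative ?D (w x) dw) (at x)"
      using w dird_has_derivative[OF H] by (auto intro!: derivative_eq_intros simp: add.commute)
    then show ?thesis
      by (rule has_derivative_transform_within_open[OF _ S]) (rule exp[symmetric])
  qed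
  show "(\<lambda>y. H y (w y)) differentiable (at x)"
    using key[OF dird_has_derivative[OF w]] by (auto simp: differentiable_def)
  have 1: "dird (\<lambda>y. H y (w y)) x v = ?D (w x) (dird w x) v"
    by (rule dird_eqI[OF key[OF dird_has_derivative[OF w]]])
  have 2: "dird (\<lambda>y. H y (w x)) x v = ?D (w x) (\<lambda>_. 0) v"
    by (rule dird_eqI[OF key[OF has_derivative_const]])
  show "dird (\<lambda>y. H y (w y)) x v = dird (\<lambda>y. H y (w x)) x v + H x (dird w x v)"
    unfolding 1 2 exp[OF S(2), of "dird w x v"] by (simp add: sum.distrib)
qed

text \<open>The coordinate model: the Reeb field is the constant \<open>e\<^sub>0\<close>, so Lie
  derivatives along it are derivatives of coefficients. \<open>\<Omega>_const\<close> says that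
  d\<eta> is invariant under the flow and \<open>h_def\<close> that \<open>h\<close> is half the Lie
  derivative of \<open>\<phi>\<close>. The invariance is an axiom here and is later verified from
  the fibration, which avoids interchanging second derivatives of \<open>\<eta>\<close>.\<close>

locale reeb_coords =
  fixes S :: "'e::euclidean_space set" and e\<^sub>0 :: 'e and G :: "'e \<Rightarrow> 'e \<Rightarrow> 'e \<Rightarrow> real"
    and \<eta> :: "'e \<Rightarrow> 'e \<Rightarrow> real" and \<phi> h :: "'e \<Rightarrow> 'e \<Rightarrow> 'e"
  assumes open_S: "open S"
    and G_lin: "y \<in> S \<Longrightarrow> linear (G y u)"
    and G_sym: "y \<in> S \<Longrightarrow> G y u v = G y v u"
    and G_pos: "y \<in> S \<Longrightarrow> u \<noteq> 0 \<Longrightarrow> G y u u > 0"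
    and G_diff: "y \<in> S \<Longrightarrow> (\<lambda>y. G y u v) differentiable (at y)"
    and \<phi>_lin: "y \<in> S \<Longrightarrow> linear (\<phi> y)"
    and \<phi>_diff: "y \<in> S \<Longrightarrow> (\<lambda>y. \<phi> y u) differentiable (at y)"
    and h_lin: "y \<in> S \<Longrightarrow> linear (h y)"
    and h_diff: "y \<in> S \<Longrightarrow> (\<lambda>y. h y u) differentiable (at y)"
    and \<eta>_G: "y \<in> S \<Longrightarrow> \<eta> y v = G y e\<^sub>0 v"
    and \<eta>_e0: "y \<in> S \<Longrightarrow> \<eta> y e\<^sub>0 = 1"
    and \<phi>_sq: "y \<in> S \<Longrightarrow> \<phi> y (\<phi> y v) = - v + \<eta> y v *\<^sub>R e\<^sub>0"
    and d\<eta>: "y \<in> S \<Longrightarrow> G y u (\<phi> y v) = ext_d1 \<eta> y u v"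
    and d\<eta>_e0: "y \<in> S \<Longrightarrow> ext_d1 \<eta> y e\<^sub>0 v = 0"
    and \<Omega>_const: "y \<in> S \<Longrightarrow> dird (\<lambda>y. G y u (\<phi> y v)) y e\<^sub>0 = 0"
    and h_def: "y \<in> S \<Longrightarrow> dird (\<lambda>y. \<phi> y u) y e\<^sub>0 = 2 *\<^sub>R h y u"
begin

section \<open>Algebra of the structure tensors and their Lie derivatives along the Reeb
  field\<close>

lemma G_lin2: "y \<in> S \<Longrightarrow> linear (\<lambda>u. G y u v)"
  using G_lin[of y v] G_sym by (simp add: linear_iff)

lemmas G_simps = linear_add[OF G_lin] linear_scale[OF G_lin] linear_neg[OF G_lin]
  linear_diff[OF G_lin] linear_0[OF G_lin]
  linear_add[OF G_lin2] linear_scale[OF G_lin2] linear_neg[OF G_lin2]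
  linear_diff[OF G_lin2] linear_0[OF G_lin2]
lemmas \<phi>_simps = linear_add[OF \<phi>_lin] linear_scale[OF \<phi>_lin] linear_neg[OF \<phi>_lin]
  linear_diff[OF \<phi>_lin] linear_0[OF \<phi>_lin]
lemmas h_simps = linear_add[OF h_lin] linear_scale[OF h_lin] linear_neg[OF h_lin]
  linear_diff[OF h_lin] linear_0[OF h_lin]

lemma \<eta>_lin: "y \<in> S \<Longrightarrow> linear (\<eta> y)"
  using G_lin[of y e\<^sub>0] \<eta>_G by (simp add: linear_iff)

lemmas \<eta>_simps = linear_add[OF \<eta>_lin] linear_scale[OF \<eta>_lin] linear_neg[OF \<eta>_lin]
  linear_diff[OF \<eta>_lin] linear_0[OF \<eta>_lin]

lemma G_eqI:
  assumes "y \<in> S" "\<And>z. G y u z = G y v z" shows "u = v"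
proof (rule ccontr)
  assume "u \<noteq> v"
  then have "G y (u - v) (u - v) > 0" using G_pos[OF assms(1)] by simp
  then show False using assms by (simp add: G_simps)
qed

text \<open>Inherited from the antisymmetry of \<open>ext_d1\<close> through
  \<open>d\<eta>\<close>.\<close>

lemma \<phi>_skew: "y \<in> S \<Longrightarrow> G y (\<phi> y u) v = - G y u (\<phi> y v)"
  using d\<eta>[of y u v] d\<eta>[of y v u] G_sym[of y "\<phi> y u" v] by (simp add: ext_d1_def)

lemma \<eta>_\<phi>: "y \<in> S \<Longrightarrow> \<eta> y (\<phi> y v) = 0"
  using d\<eta>[of y e\<^sub>0 v] d\<eta>_e0 by (simp add: \<eta>_G)

lemma \<phi>_e0: assumes y: "y \<in> S" shows "\<phi> y e\<^sub>0 = 0"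
proof -
  have "\<phi> y (\<phi> y e\<^sub>0) = 0" using y by (simp add: \<phi>_sq \<eta>_e0)
  \<comment> \<open>The threefold image of \<open>e\<^sub>0\<close> is computed in two ways: from
    the vanishing of the twofold image, and by \<open>\<phi>_sq\<close> at the vector
    \<open>\<phi> y e\<^sub>0\<close>.\<close>
  then have "\<phi> y (\<phi> y (\<phi> y e\<^sub>0)) = 0" using linear_0[OF \<phi>_lin[OF y]] by (simp only:)
  then have "- \<phi> y e\<^sub>0 + \<eta> y (\<phi> y e\<^sub>0) *\<^sub>R e\<^sub>0 = 0" unfolding \<phi>_sq[OF y, of "\<phi> y e\<^sub>0"] .
  then show ?thesis using y by (simp add: \<eta>_\<phi>)
qed

text \<open>Cartan's formula: the Lie derivative of \<eta> along \<xi> comes from the contraction of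
  d\<eta> with \<xi> and the differential of \<eta>(\<xi>), and both vanish.\<close>

lemma \<eta>_const: assumes y: "y \<in> S" shows "dird (\<lambda>y. \<eta> y v) y e\<^sub>0 = 0"
proof -
  have "dird (\<lambda>y. \<eta> y e\<^sub>0) y v = 0"
    by (rule dird_const_near[OF open_S y]) (rule \<eta>_e0)
  then show ?thesis using d\<eta>_e0[OF y, of v] by (simp add: ext_d1_def)
qed

lemma \<eta>_diff: "y \<in> S \<Longrightarrow> (\<lambda>y. \<eta> y v) differentiable (at y)"
  by (rule differentiable_cong[OF open_S _ \<eta>_G G_diff])

text \<open>This and the next two lemmas differentiate an algebraic identity along
  \<open>e\<^sub>0\<close>: successively \<open>\<phi>_e0\<close>, \<open>\<eta>_\<phi>\<close> and
  \<open>\<phi>_sq\<close>.\<close>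

lemma h_e0: assumes y: "y \<in> S" shows "h y e\<^sub>0 = 0"
proof -
  have "dird (\<lambda>y. \<phi> y e\<^sub>0) y e\<^sub>0 = 0"
    by (rule dird_const_near[OF open_S y]) (rule \<phi>_e0)
  then show ?thesis using h_def[OF y, of e\<^sub>0] by simp
qed

lemma \<eta>_h: assumes y: "y \<in> S" shows "\<eta> y (h y v) = 0"
proof -
  have "dird (\<lambda>y. \<eta> y (\<phi> y v)) y e\<^sub>0 = 0"
    by (rule dird_const_near[OF open_S y]) (rule \<eta>_\<phi>)
  moreover have "dird (\<lambda>y. \<eta> y (\<phi> y v)) y e\<^sub>0
      = dird (\<lambda>z. \<eta> z (\<phi> y v)) y e\<^sub>0 + \<eta> y (dird (\<lambda>y. \<phi> y v) y e\<^sub>0)"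
    by (rule dird_apply(2)[OF open_S y \<eta>_lin \<eta>_diff[OF y] \<phi>_diff[OF y]])
  ultimately show ?thesis using y by (simp add: \<eta>_const h_def \<eta>_simps)
qed

lemma h_\<phi>: assumes y: "y \<in> S" shows "h y (\<phi> y v) = - \<phi> y (h y v)"
proof -
  have "dird (\<lambda>y. \<phi> y (\<phi> y v)) y e\<^sub>0
      = dird (\<lambda>z. \<phi> z (\<phi> y v)) y e\<^sub>0 + \<phi> y (dird (\<lambda>y. \<phi> y v) y e\<^sub>0)"
    by (rule dird_apply(2)[OF open_S y \<phi>_lin \<phi>_diff[OF y] \<phi>_diff[OF y]])
  also have "\<dots> = 2 *\<^sub>R (h y (\<phi> y v) + \<phi> y (h y v))"
    using y by (simp add: h_def \<phi>_simps scaleR_add_right)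
  finally have 1: "dird (\<lambda>y. \<phi> y (\<phi> y v)) y e\<^sub>0 = 2 *\<^sub>R (h y (\<phi> y v) + \<phi> y (h y v))" .
  have "((\<lambda>y. - v + \<eta> y v *\<^sub>R e\<^sub>0) has_derivative (\<lambda>u. dird (\<lambda>y. \<eta> y v) y u *\<^sub>R e\<^sub>0)) (at y)"
    using dird_has_derivative[OF \<eta>_diff[OF y]] by (auto intro!: derivative_eq_intros)
  then have "dird (\<lambda>y. - v + \<eta> y v *\<^sub>R e\<^sub>0) y e\<^sub>0 = 0"
    using \<eta>_const[OF y] by (simp add: dird_eqI)
  moreover have "dird (\<lambda>y. \<phi> y (\<phi> y v)) y e\<^sub>0 = dird (\<lambda>y. - v + \<eta> y v *\<^sub>R e\<^sub>0) y e\<^sub>0"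
    by (rule dird_cong[OF open_S y \<phi>_sq])
  ultimately show ?thesis using 1 by (simp add: eq_neg_iff_add_eq_0)
qed

text \<open>Since the form G(u, \<phi> w) is invariant, the derivative of the metric at (u, \<phi>
  w) must cancel the contribution 2 G(u, h w) of \<phi>. Every \<open>v\<close> is \<phi> w plus a
  multiple of \<open>e\<^sub>0\<close> with w = - \<phi> v, and the multiple contributes nothing
  because G(u, \<open>e\<^sub>0\<close>) = \<eta>(u).\<close>

lemma dird_G: assumes y: "y \<in> S" shows "dird (\<lambda>y. G y u v) y e\<^sub>0 = 2 * G y u (h y (\<phi> y v))"
proof -
  have *: "dird (\<lambda>z. G z u (\<phi> y w)) y e\<^sub>0 = - 2 * G y u (h y w)" for w
    using dird_apply(2)[OF open_S y G_lin G_diff[OF y] \<phi>_diff[OF y], where v = e\<^sub>0, of u w]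
      \<Omega>_const[OF y, of u w] y by (simp add: h_def G_simps)
  have lin: "dird (\<lambda>z. G z u (a + r *\<^sub>R b)) y e\<^sub>0 = dird (\<lambda>z. G z u a) y e\<^sub>0 + r * dird (\<lambda>z. G z u b) y e\<^sub>0"
    for a b r
  proof -
    have "((\<lambda>z. G z u a + r * G z u b) has_derivative
        (\<lambda>w. dird (\<lambda>z. G z u a) y w + r * dird (\<lambda>z. G z u b) y w)) (at y)"
      using G_diff[OF y] by (auto intro!: derivative_intros dird_has_derivative)
    moreover have "dird (\<lambda>z. G z u (a + r *\<^sub>R b)) y e\<^sub>0 = dird (\<lambda>z. G z u a + r * G z u b) y e\<^sub>0"
      by (rule dird_cong[OF open_S y]) (simp add: G_simps)
    ultimately show ?thesis by (simp add: dird_eqI)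
  qed
  have e: "dird (\<lambda>z. G z u e\<^sub>0) y e\<^sub>0 = 0"
  proof -
    have "dird (\<lambda>z. G z u e\<^sub>0) y e\<^sub>0 = dird (\<lambda>z. \<eta> z u) y e\<^sub>0"
      by (rule dird_cong[OF open_S y]) (simp add: \<eta>_G G_sym)
    then show ?thesis using \<eta>_const[OF y] by simp
  qed
  have "v = \<eta> y v *\<^sub>R e\<^sub>0 + (- 1) *\<^sub>R \<phi> y (\<phi> y v)" using y by (simp add: \<phi>_sq)
  then have "dird (\<lambda>z. G z u v) y e\<^sub>0 = dird (\<lambda>z. G z u (\<eta> y v *\<^sub>R e\<^sub>0 + (- 1) *\<^sub>R \<phi> y (\<phi> y v))) y e\<^sub>0"
    by simp
  \<comment> \<open>The summand 0 lets \<open>lin\<close> extract the scalar of the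
    \<open>e\<^sub>0\<close> part.\<close>
  also have "\<dots> = dird (\<lambda>z. G z u (0 + \<eta> y v *\<^sub>R e\<^sub>0)) y e\<^sub>0 - dird (\<lambda>z. G z u (\<phi> y (\<phi> y v))) y e\<^sub>0"
    unfolding lin[of "\<eta> y v *\<^sub>R e\<^sub>0"] by simp
  also have "\<dots> = 2 * G y u (h y (\<phi> y v))"
    unfolding lin[of 0] * using e * [of 0] y by (simp add: \<phi>_simps h_simps G_simps)
  finally show ?thesis .
qed

text \<open>By \<open>dird_G\<close> this bilinear form is half the derivative of a symmetric
  form.\<close>

lemma h\<phi>_sym: assumes y: "y \<in> S" shows "G y u (h y (\<phi> y v)) = G y (h y (\<phi> y u)) v"
proof -
  have "dird (\<lambda>y. G y u v) y e\<^sub>0 = dird (\<lambda>y. G y v u) y e\<^sub>0"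
    by (rule dird_cong[OF open_S y G_sym])
  then show ?thesis using y by (simp add: dird_G G_sym)
qed

section \<open>The covariant derivative of the Reeb field and the curvature\<close>

lemma christoffel_e0:
  assumes y: "y \<in> S" shows "christoffel G y v e\<^sub>0 = - \<phi> y v + h y (\<phi> y v)"
  unfolding christoffel_def
proof (rule the_equality)
  have 1: "dird (\<lambda>y. G y e\<^sub>0 z) y u = dird (\<lambda>y. \<eta> y z) y u" for z u
    by (rule dird_cong[OF open_S y]) (simp add: \<eta>_G)
  have 2: "dird (\<lambda>y. G y v e\<^sub>0) y u = dird (\<lambda>y. \<eta> y v) y u" for u
    by (rule dird_cong[OF open_S y]) (simp add: \<eta>_G G_sym)
  show eq: "\<forall>z. G y (- \<phi> y v + h y (\<phi> y v)) z = 1 / 2 *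
     (dird (\<lambda>y. G y e\<^sub>0 z) y v + dird (\<lambda>y. G y v z) y e\<^sub>0 - dird (\<lambda>y. G y v e\<^sub>0) y z)"
  proof
    fix z
    \<comment> \<open>In the Koszul formula the outer terms combine to d\<eta>(v, z), which gives -
      \<phi> v, and the middle one is half the Lie derivative of the metric, which gives h \<phi>
      v.\<close>
    have "1 / 2 * (dird (\<lambda>y. \<eta> y z) y v + dird (\<lambda>y. G y v z) y e\<^sub>0 - dird (\<lambda>y. \<eta> y v) y z)
      = ext_d1 \<eta> y v z + G y v (h y (\<phi> y z))"
      using y by (simp add: ext_d1_def dird_G algebra_simps)
    also have "\<dots> = G y (- \<phi> y v + h y (\<phi> y v)) z"
      using y by (simp add: d\<eta>[symmetric] h\<phi>_sym \<phi>_skew G_simps)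
    finally show "G y (- \<phi> y v + h y (\<phi> y v)) z = 1 / 2 *
       (dird (\<lambda>y. G y e\<^sub>0 z) y v + dird (\<lambda>y. G y v z) y e\<^sub>0 - dird (\<lambda>y. G y v e\<^sub>0) y z)"
      unfolding 1 2 by simp
  qed
  show "w = - \<phi> y v + h y (\<phi> y v)" if "\<forall>z. G y w z = 1 / 2 *
     (dird (\<lambda>y. G y e\<^sub>0 z) y v + dird (\<lambda>y. G y v z) y e\<^sub>0 - dird (\<lambda>y. G y v e\<^sub>0) y z)" for w
    using G_eqI[OF y, of w] that eq by simp
qed

lemma christoffel_commute: "y \<in> S \<Longrightarrow> christoffel G y u v = christoffel G y v u"
  unfolding christoffel_def
  using dird_cong[where f = "\<lambda>z. G z u v" and g = "\<lambda>z. G z v u", OF open_S _ G_sym, of y]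
  by (simp add: add.commute)

text \<open>Reeb orbits are geodesics and the two constant fields commute, so only minus the
  covariant derivative along \<open>e\<^sub>0\<close> of the field - \<phi> u + h \<phi> u survives.
  \<open>Z\<close> is constrained on \<open>S\<close> only, because \<open>rep_vf\<close> has
  arbitrary values outside the chart range.\<close>

lemma curvature_e0:
  assumes x: "x \<in> S" and Z: "\<And>y. y \<in> S \<Longrightarrow> Z y = e\<^sub>0"
  shows "curvature G (\<lambda>_. u) (\<lambda>_. e\<^sub>0) Z x =
    2 *\<^sub>R h x u - dird (\<lambda>y. h y (\<phi> x u)) x e\<^sub>0 - 2 *\<^sub>R h x (h x u)
    - (- \<phi> x (- \<phi> x u + h x (\<phi> x u)) + h x (\<phi> x (- \<phi> x u + h x (\<phi> x u))))"
proof -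
  have LC: "levi_civita G (\<lambda>_. v) Z y = - \<phi> y v + h y (\<phi> y v)" if "y \<in> S" for y v
    using that dird_const_near[OF open_S that Z] by (simp add: levi_civita_def Z christoffel_e0)
  have 1: "levi_civita G (\<lambda>_. u) (levi_civita G (\<lambda>_. e\<^sub>0) Z) x = 0"
  proof -
    have *: "levi_civita G (\<lambda>_. e\<^sub>0) Z y = 0" if "y \<in> S" for y
      using that by (simp add: LC \<phi>_e0 h_simps)
    \<comment> \<open>\<open>christoffel\<close> is a definite description, so its value at the zero
      vector is read off from the defining equation.\<close>
    have "christoffel G x u 0 = 0"
    proof -
      have "dird (\<lambda>y. G y 0 z) x v = 0" "dird (\<lambda>y. G y v 0) x z = 0" for z v
        by (rule dird_const_near[OF open_S x]; simp add: G_simps)+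
      moreover have "(THE w. \<forall>z. G x w z = 1 / 2 * dird (\<lambda>y. G y u z) x 0) = 0"
      proof (rule the_equality)
        show *: "\<forall>z. G x 0 z = 1 / 2 * dird (\<lambda>y. G y u z) x 0"
          using x linear_0[OF linear_dird[OF G_diff[OF x]]] by (simp add: G_simps)
        show "w = 0" if "\<forall>z. G x w z = 1 / 2 * dird (\<lambda>y. G y u z) x 0" for w
          by (rule G_eqI[OF x]) (metis that *)
      qed
      ultimately show ?thesis by (simp add: christoffel_def)
    qed
    moreover have "dird (levi_civita G (\<lambda>_. e\<^sub>0) Z) x u = 0"
      by (rule dird_const_near[OF open_S x *])
    ultimately show ?thesis unfolding levi_civita_def[of G "\<lambda>_. u"] *[OF x] by simp
  qed
  have "((\<lambda>y. - \<phi> y u + h y (\<phi> y u)) has_derivative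
      (\<lambda>v. - dird (\<lambda>y. \<phi> y u) x v + dird (\<lambda>y. h y (\<phi> y u)) x v)) (at x)"
    using dird_apply(1)[OF open_S x h_lin h_diff[OF x] \<phi>_diff[OF x]] \<phi>_diff[OF x]
    by (intro derivative_intros dird_has_derivative)
  then have "dird (\<lambda>y. - \<phi> y u + h y (\<phi> y u)) x e\<^sub>0
      = - 2 *\<^sub>R h x u + dird (\<lambda>y. h y (\<phi> y u)) x e\<^sub>0"
    using x by (simp add: dird_eqI h_def)
  also have "dird (\<lambda>y. h y (\<phi> y u)) x e\<^sub>0 = dird (\<lambda>y. h y (\<phi> x u)) x e\<^sub>0 + 2 *\<^sub>R h x (h x u)"
    using dird_apply(2)[OF open_S x h_lin h_diff[OF x] \<phi>_diff[OF x]] x by (simp add: h_def h_simps)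
  finally have 2: "dird (levi_civita G (\<lambda>_. u) Z) x e\<^sub>0
      = - 2 *\<^sub>R h x u + (dird (\<lambda>y. h y (\<phi> x u)) x e\<^sub>0 + 2 *\<^sub>R h x (h x u))"
    using dird_cong[OF open_S x LC] by simp
  \<comment> \<open>Symmetry of the Christoffel symbols moves \<open>e\<^sub>0\<close> into the
    second slot, where \<open>christoffel_e0\<close> applies.\<close>
  have 3: "levi_civita G (\<lambda>_. e\<^sub>0) (levi_civita G (\<lambda>_. u) Z) x
     = - 2 *\<^sub>R h x u + (dird (\<lambda>y. h y (\<phi> x u)) x e\<^sub>0 + 2 *\<^sub>R h x (h x u))
     + (- \<phi> x (- \<phi> x u + h x (\<phi> x u)) + h x (\<phi> x (- \<phi> x u + h x (\<phi> x u))))"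
    unfolding levi_civita_def[of G "\<lambda>_. e\<^sub>0"] 2 christoffel_commute[OF x, of e\<^sub>0] LC[OF x]
      christoffel_e0[OF x] ..
  have "vf_bracket (\<lambda>_. u) (\<lambda>_. e\<^sub>0) = (\<lambda>_. 0 :: 'e)"
    by (rule ext) (simp add: vf_bracket_def frechet_derivative_const)
  then have 4: "levi_civita G (vf_bracket (\<lambda>_. u) (\<lambda>_. e\<^sub>0)) Z x = 0"
    using LC[OF x, of 0] x by (simp add: \<phi>_simps h_simps)
  show ?thesis unfolding curvature_def 1 3 4 by (simp add: algebra_simps)
qed

section \<open>Consequences of the curvature condition on the contact distribution\<close>

lemma ker_eqI:
  assumes y: "y \<in> S" and "\<eta> y u = 0" "\<eta> y v = 0" "\<And>z. \<eta> y z = 0 \<Longrightarrow> G y u z = G y v z"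
  shows "u = v"
proof (rule ccontr)
  assume "u \<noteq> v"
  then have "G y (u - v) (u - v) > 0" using G_pos[OF y] by simp
  moreover have "\<eta> y (u - v) = 0" using assms by (simp add: \<eta>_simps)
  then have "G y (u - v) (u - v) = 0" using assms by (simp add: G_simps(9))
  ultimately show False by simp
qed

lemma dird_h_lin: assumes x: "x \<in> S" shows "linear (\<lambda>u. dird (\<lambda>y. h y u) x e\<^sub>0)"
proof (rule linearI)
  fix u v r
  note d = dird_has_derivative[OF h_diff[OF x]]
  have "dird (\<lambda>y. h y (u + v)) x e\<^sub>0 = dird (\<lambda>y. h y u + h y v) x e\<^sub>0"
    by (rule dird_cong[OF open_S x]) (simp add: h_simps)
  then show "dird (\<lambda>y. h y (u + v)) x e\<^sub>0 = dird (\<lambda>y. h y u) x e\<^sub>0 + dird (\<lambda>y. h y v) x e\<^sub>0"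
    by (simp add: dird_eqI[OF has_derivative_add[OF d d]])
  have "dird (\<lambda>y. h y (r *\<^sub>R u)) x e\<^sub>0 = dird (\<lambda>y. r *\<^sub>R h y u) x e\<^sub>0"
    by (rule dird_cong[OF open_S x]) (simp add: h_simps)
  then show "dird (\<lambda>y. h y (r *\<^sub>R u)) x e\<^sub>0 = r *\<^sub>R dird (\<lambda>y. h y u) x e\<^sub>0"
    by (simp add: dird_eqI[OF has_derivative_scaleR_right[OF d]])
qed

text \<open>Let k be the derivative of h along the flow. The curvature condition gives k \<phi> in
  terms of h and its square, while differentiating h \<phi> = - \<phi> h gives the anticommutator of
  k and \<phi>. Comparing the two at u and \<phi> u determines the square of h, and substituting
  back determines k.\<close>

lemma kappa_mu_structure:
  assumes x: "x \<in> S" and Z: "\<And>y. y \<in> S \<Longrightarrow> Z y = e\<^sub>0"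
    and R: "\<And>u. curvature G (\<lambda>_. u) (\<lambda>_. e\<^sub>0) Z x =
      \<kappa> *\<^sub>R (\<eta> x e\<^sub>0 *\<^sub>R u - \<eta> x u *\<^sub>R e\<^sub>0) +
      \<mu> *\<^sub>R (\<eta> x e\<^sub>0 *\<^sub>R h x u - \<eta> x u *\<^sub>R h x e\<^sub>0)"
    and v: "\<eta> x v = 0"
  shows "h x (h x v) = (1 - \<kappa>) *\<^sub>R v"
    and "dird (\<lambda>y. h y v) x e\<^sub>0 = (2 * (1 - \<kappa>)) *\<^sub>R \<phi> x v - (2 - \<mu>) *\<^sub>R h x (\<phi> x v)"
proof -
  let ?k = "\<lambda>u. dird (\<lambda>y. h y u) x e\<^sub>0"
  note k_simps = linear_add[OF dird_h_lin] linear_scale[OF dird_h_lin] linear_neg[OF dird_h_lin]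
  have sq: "\<phi> x (\<phi> x u) = - u" if "\<eta> x u = 0" for u using that x by (simp add: \<phi>_sq)
  have k\<phi>: "?k (\<phi> x u) = (2 - \<mu>) *\<^sub>R h x u - 3 *\<^sub>R h x (h x u) + (1 - \<kappa>) *\<^sub>R u"
    if u: "\<eta> x u = 0" for u
  proof -
    have 1: "\<phi> x (h x (\<phi> x u)) = h x u"
      using x u sq[of "h x u"] by (simp add: h_\<phi> \<phi>_simps \<eta>_h)
    have 2: "curvature G (\<lambda>_. u) (\<lambda>_. e\<^sub>0) Z x
        = 2 *\<^sub>R h x u - ?k (\<phi> x u) - 3 *\<^sub>R h x (h x u) + u"
    proof -
      have C: "curvature G (\<lambda>_. u) (\<lambda>_. e\<^sub>0) Z x =
        2 *\<^sub>R h x u - ?k (\<phi> x u) - 2 *\<^sub>R h x (h x u)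
        - (- \<phi> x (- \<phi> x u + h x (\<phi> x u)) + h x (\<phi> x (- \<phi> x u + h x (\<phi> x u))))"
        by (rule curvature_e0[OF x]) (rule Z)
      show ?thesis
      unfolding C using x u
      by (simp add: \<phi>_simps h_simps sq 1 algebra_simps) (use scaleR_left_distrib[of 1 2 "h x (h x u)"] in simp)
    qed
    have "2 *\<^sub>R h x u - ?k (\<phi> x u) - 3 *\<^sub>R h x (h x u) + u = \<kappa> *\<^sub>R u + \<mu> *\<^sub>R h x u"
      using R[of u] x u unfolding 2 by (simp add: \<eta>_e0)
    then show ?thesis by (simp add: algebra_simps)
  qed
  \<comment> \<open>The derivative of \<open>h_\<phi>\<close> along \<open>e\<^sub>0\<close>: each
    side contributes \<open>2 *\<^sub>R h x (h x u)\<close> from the derivative of \<phi>, whence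
    the factor 4.\<close>
  have \<phi>k: "\<phi> x (?k u) = - 4 *\<^sub>R h x (h x u) - ?k (\<phi> x u)" for u
  proof -
    have "dird (\<lambda>y. h y (\<phi> y u)) x e\<^sub>0 = ?k (\<phi> x u) + 2 *\<^sub>R h x (h x u)"
      using dird_apply(2)[OF open_S x h_lin h_diff[OF x] \<phi>_diff[OF x]] x by (simp add: h_def h_simps)
    moreover have "dird (\<lambda>y. \<phi> y (h y u)) x e\<^sub>0 = 2 *\<^sub>R h x (h x u) + \<phi> x (?k u)"
      using dird_apply(2)[OF open_S x \<phi>_lin \<phi>_diff[OF x] h_diff[OF x]] x by (simp add: h_def)
    moreover have "dird (\<lambda>y. h y (\<phi> y u)) x e\<^sub>0 = dird (\<lambda>y. - \<phi> y (h y u)) x e\<^sub>0"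
      by (rule dird_cong[OF open_S x h_\<phi>])
    moreover have "dird (\<lambda>y. - \<phi> y (h y u)) x e\<^sub>0 = - dird (\<lambda>y. \<phi> y (h y u)) x e\<^sub>0"
      by (rule dird_eqI[OF has_derivative_minus[OF dird_has_derivative]])
        (rule dird_apply(1)[OF open_S x \<phi>_lin \<phi>_diff[OF x] h_diff[OF x]])
    ultimately have "(?k (\<phi> x u) + 2 *\<^sub>R h x (h x u)) + (2 *\<^sub>R h x (h x u) + \<phi> x (?k u)) = 0"
      by (metis add.left_inverse)
    then have "?k (\<phi> x u) + \<phi> x (?k u) = - (4 *\<^sub>R h x (h x u))"
      unfolding eq_neg_iff_add_eq_0
      using scaleR_left_distrib[of 2 2 "h x (h x u)"] by (simp add: algebra_simps)
    then show ?thesis by (simp add: algebra_simps)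
  qed
  have hh\<phi>: "h x (h x (\<phi> x u)) = \<phi> x (h x (h x u))" for u
    using x by (simp add: h_\<phi> h_simps)
  have sq_h: "\<phi> x (h x (h x u)) = (1 - \<kappa>) *\<^sub>R \<phi> x u" if u: "\<eta> x u = 0" for u
  proof -
    \<comment> \<open>At \<phi> u both sides are known through \<open>k\<phi>\<close>. The terms
      with 2 - \<mu> cancel since h anticommutes with \<phi>.\<close>
    have "\<phi> x (?k (\<phi> x u)) = - 4 *\<^sub>R \<phi> x (h x (h x u)) - ?k (\<phi> x (\<phi> x u))"
      using \<phi>k[of "\<phi> x u"] by (simp add: hh\<phi>)
    also have "?k (\<phi> x (\<phi> x u)) = - (2 - \<mu>) *\<^sub>R \<phi> x (h x u) - 3 *\<^sub>R \<phi> x (h x (h x u)) + (1 - \<kappa>) *\<^sub>R \<phi> x u"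
      using k\<phi>[of "\<phi> x u"] x by (simp add: \<eta>_\<phi> h_\<phi> h_simps algebra_simps)
    also have "\<phi> x (?k (\<phi> x u)) = (2 - \<mu>) *\<^sub>R \<phi> x (h x u) - 3 *\<^sub>R \<phi> x (h x (h x u)) + (1 - \<kappa>) *\<^sub>R \<phi> x u"
      using k\<phi>[OF u] x by (simp add: \<phi>_simps)
    finally have eq: "(2 - \<mu>) *\<^sub>R \<phi> x (h x u) - 3 *\<^sub>R \<phi> x (h x (h x u)) + (1 - \<kappa>) *\<^sub>R \<phi> x u
      = - 4 *\<^sub>R \<phi> x (h x (h x u)) - (- (2 - \<mu>) *\<^sub>R \<phi> x (h x u)
        - 3 *\<^sub>R \<phi> x (h x (h x u)) + (1 - \<kappa>) *\<^sub>R \<phi> x u)" .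
    show ?thesis
    proof (rule euclidean_eqI)
      fix b :: 'e
      show "\<phi> x (h x (h x u)) \<bullet> b = ((1 - \<kappa>) *\<^sub>R \<phi> x u) \<bullet> b"
        using arg_cong[OF eq, of "\<lambda>z. z \<bullet> b"] by (simp add: inner_simps algebra_simps)
    qed
  qed
  show hh: "h x (h x v) = (1 - \<kappa>) *\<^sub>R v"
  proof -
    have "\<phi> x (\<phi> x (h x (h x v))) = (1 - \<kappa>) *\<^sub>R \<phi> x (\<phi> x v)"
      unfolding sq_h[OF v] using x by (simp add: \<phi>_simps)
    then show ?thesis using v x by (simp add: sq \<eta>_h)
  qed
  have "?k v = - ?k (\<phi> x (\<phi> x v))" using x v by (simp add: sq k_simps)
  also have "\<dots> = - ((2 - \<mu>) *\<^sub>R h x (\<phi> x v) - 3 *\<^sub>R ((1 - \<kappa>) *\<^sub>R \<phi> x v) + (1 - \<kappa>) *\<^sub>R \<phi> x v)"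
    using k\<phi>[of "\<phi> x v"] x v by (simp add: \<eta>_\<phi> hh\<phi> hh \<phi>_simps)
  also have "\<dots> = (2 * (1 - \<kappa>)) *\<^sub>R \<phi> x v - (2 - \<mu>) *\<^sub>R h x (\<phi> x v)"
    by (rule euclidean_eqI) (simp add: inner_simps algebra_simps)
  finally show "?k v = (2 * (1 - \<kappa>)) *\<^sub>R \<phi> x v - (2 - \<mu>) *\<^sub>R h x (\<phi> x v)" .
qed

text \<open>\<psi> is one fixed linear map along the whole line, so it can be taken through the
  derivative. Used with \<open>v = \<psi> u\<close>.\<close>

lemma dird_h_anticommute:
  assumes x: "x \<in> S" and "\<epsilon> > 0" and \<psi>: "linear \<psi>"
    and "\<And>t. \<bar>t\<bar> < \<epsilon> \<Longrightarrow> \<psi> (h (x + t *\<^sub>R e\<^sub>0) u) = - h (x + t *\<^sub>R e\<^sub>0) v"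
  shows "\<psi> (dird (\<lambda>y. h y u) x e\<^sub>0) = - dird (\<lambda>y. h y v) x e\<^sub>0"
proof -
  have line: "((\<lambda>t. h (x + t *\<^sub>R e\<^sub>0) w) has_vector_derivative dird (\<lambda>y. h y w) x e\<^sub>0) (at 0)" for w
  proof -
    have "((\<lambda>t. x + t *\<^sub>R e\<^sub>0) has_derivative (\<lambda>t. t *\<^sub>R e\<^sub>0)) (at 0)"
      by (auto intro!: derivative_eq_intros)
    moreover have "((\<lambda>y. h y w) has_derivative dird (\<lambda>y. h y w) x) (at (x + 0 *\<^sub>R e\<^sub>0))"
      using dird_has_derivative[OF h_diff[OF x]] by simp
    ultimately have "((\<lambda>t. h (x + t *\<^sub>R e\<^sub>0) w) has_derivative (\<lambda>t. dird (\<lambda>y. h y w) x (t *\<^sub>R e\<^sub>0))) (at 0)"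
      by (rule has_derivative_compose)
    then show ?thesis
      by (simp add: has_vector_derivative_def linear_scale[OF linear_dird[OF h_diff[OF x]]])
  qed
  have "((\<lambda>t. \<psi> (h (x + t *\<^sub>R e\<^sub>0) u)) has_vector_derivative \<psi> (dird (\<lambda>y. h y u) x e\<^sub>0)) (at 0)"
    by (rule bounded_linear.has_vector_derivative[OF _ line]) (simp add: \<psi> linear_conv_bounded_linear[symmetric])
  moreover have "((\<lambda>t. \<psi> (h (x + t *\<^sub>R e\<^sub>0) u)) has_vector_derivative - dird (\<lambda>y. h y v) x e\<^sub>0) (at 0)"
    by (rule has_vector_derivative_transform_within_open
        [OF has_vector_derivative_minus[OF line], where S = "{-\<epsilon><..<\<epsilon>}"])
      (use assms in \<open>auto simp: abs_less_iff\<close>)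
  ultimately show ?thesis by (rule vector_derivative_unique_at)
qed

text \<open>In the next two lemmas \<open>Q\<close> is the pulled-back metric \<open>g(d\<pi>\<cdot>, d\<pi>\<cdot>)\<close> on \<open>ker \<eta>\<close>,
  \<open>\<psi>\<close> the lift of its almost complex structure and \<open>s = e\<^sup>-\<^sup>2\<^sup>f (I - T)\<close>.\<close>

lemma lifted_structure_anticommute:
  assumes y: "y \<in> S"
    and s_ker: "\<And>u. \<eta> y u = 0 \<Longrightarrow> \<eta> y (s u) = 0"
    and s_G: "\<And>u v. \<eta> y u = 0 \<Longrightarrow> \<eta> y v = 0 \<Longrightarrow> G y (s u) v = Q u v"
    and Q_sym: "\<And>u v. \<eta> y u = 0 \<Longrightarrow> \<eta> y v = 0 \<Longrightarrow> Q u v = Q v u"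
    and \<psi>_ker: "\<And>u. \<eta> y u = 0 \<Longrightarrow> \<eta> y (\<psi> u) = 0"
    and \<psi>_sq: "\<And>u. \<eta> y u = 0 \<Longrightarrow> \<psi> (\<psi> u) = - u"
    and Q_\<psi>: "\<And>u v. \<eta> y u = 0 \<Longrightarrow> \<eta> y v = 0 \<Longrightarrow> Q u (\<psi> v) = G y u (\<phi> y v)"
    and sh: "\<And>u. \<eta> y u = 0 \<Longrightarrow> s (h y u) = h y (s u)"
    and u: "\<eta> y u = 0"
  shows "s (\<psi> u) = \<phi> y u" and "s u = - \<phi> y (\<psi> u)" and "\<psi> (h y u) = - h y (\<psi> u)"
proof -
  have s\<psi>: "s (\<psi> u) = \<phi> y u" if u: "\<eta> y u = 0" for u
  proof (rule ker_eqI[OF y])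
    fix z assume z: "\<eta> y z = 0"
    have "G y (s (\<psi> u)) z = Q z (\<psi> u)" using u z by (simp add: s_G \<psi>_ker Q_sym)
    also have "\<dots> = G y (\<phi> y u) z" using y u z by (simp add: Q_\<psi> G_sym)
    finally show "G y (s (\<psi> u)) z = G y (\<phi> y u) z" .
  qed (use u y in \<open>simp_all add: s_ker \<psi>_ker \<eta>_\<phi>\<close>)
  \<comment> \<open>Linearity of \<open>s\<close> is not among the assumptions. Like here, it is
    recovered from the symmetry of \<open>Q\<close> by testing against vectors of the
    kernel.\<close>
  have s_neg: "s (- u) = - s u" if u: "\<eta> y u = 0" for u
  proof (rule ker_eqI[OF y])
    fix z assume z: "\<eta> y z = 0"
    have "G y (s (- u)) z = G y (s z) (- u)" using u z y by (simp add: s_G Q_sym[of "- u"] \<eta>_simps)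
    also have "\<dots> = - Q z u" using u z y by (simp add: s_G G_simps)
    also have "\<dots> = G y (- s u) z" using u z y by (simp add: s_G G_simps Q_sym)
    finally show "G y (s (- u)) z = G y (- s u) z" .
  qed (use u y in \<open>simp_all add: s_ker \<eta>_simps\<close>)
  have s_eq: "s u = - \<phi> y (\<psi> u)" if u: "\<eta> y u = 0" for u
    using s\<psi>[of "\<psi> u"] u by (simp add: \<psi>_ker \<psi>_sq s_neg minus_equation_iff[of "s u"])
  show "s (\<psi> u) = \<phi> y u" "s u = - \<phi> y (\<psi> u)" using s\<psi> s_eq u by blast+
  have "\<phi> y (\<psi> (h y u)) = - \<phi> y (h y (\<psi> u))"
  proof -
    have "- \<phi> y (\<psi> (h y u)) = s (h y u)" using y by (simp add: s_eq \<eta>_h)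
    also have "\<dots> = \<phi> y (h y (\<psi> u))" using y u by (simp add: sh s_eq h_simps h_\<phi>)
    finally show ?thesis by (metis minus_minus)
  qed
  \<comment> \<open>A second \<phi> cancels the first, as \<phi> squares to - I on the
    kernel.\<close>
  then have "\<phi> y (\<phi> y (\<psi> (h y u))) = - \<phi> y (\<phi> y (h y (\<psi> u)))" using y by (simp add: \<phi>_simps)
  then have "- \<psi> (h y u) = h y (\<psi> u)" using y by (simp add: \<phi>_sq \<psi>_ker \<eta>_h)
  then show "\<psi> (h y u) = - h y (\<psi> u)" by (metis minus_minus)
qed

lemma error_on_eigenspaces:
  fixes l a :: real
  assumes x: "x \<in> S" and l: "l > 0"
    and hh: "\<And>u. \<eta> x u = 0 \<Longrightarrow> h x (h x u) = (l * l) *\<^sub>R u"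
    and k: "\<And>u. \<eta> x u = 0 \<Longrightarrow> k u = (2 * (l * l)) *\<^sub>R \<phi> x u - a *\<^sub>R h x (\<phi> x u)"
    and k_\<psi>: "\<And>u. \<eta> x u = 0 \<Longrightarrow> \<psi> (k u) = - k (\<psi> u)"
    and s_ker: "\<And>u. \<eta> x u = 0 \<Longrightarrow> \<eta> x (s u) = 0"
    and s_G: "\<And>u v. \<eta> x u = 0 \<Longrightarrow> \<eta> x v = 0 \<Longrightarrow> G x (s u) v = Q u v"
    and Q_sym: "\<And>u v. \<eta> x u = 0 \<Longrightarrow> \<eta> x v = 0 \<Longrightarrow> Q u v = Q v u"
    and Q_pos: "\<And>u. \<eta> x u = 0 \<Longrightarrow> u \<noteq> 0 \<Longrightarrow> Q u u > 0"
    and \<psi>_ker: "\<And>u. \<eta> x u = 0 \<Longrightarrow> \<eta> x (\<psi> u) = 0"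
    and \<psi>_sq: "\<And>u. \<eta> x u = 0 \<Longrightarrow> \<psi> (\<psi> u) = - u"
    and Q_\<psi>: "\<And>u v. \<eta> x u = 0 \<Longrightarrow> \<eta> x v = 0 \<Longrightarrow> Q u (\<psi> v) = G x u (\<phi> x v)"
    and sh: "\<And>u. \<eta> x u = 0 \<Longrightarrow> s (h x u) = h x (s u)"
    and nontriv: "\<exists>u. u \<noteq> 0 \<and> \<eta> x u = 0"
  shows "\<bar>a\<bar> > 2 * l"
    and "\<eta> x u = 0 \<Longrightarrow> h x u = l *\<^sub>R u \<Longrightarrow> s u = sqrt ((a + 2 * l) / (a - 2 * l)) *\<^sub>R u"
    and "\<eta> x u = 0 \<Longrightarrow> h x u = (- l) *\<^sub>R u \<Longrightarrow> s u = sqrt ((a - 2 * l) / (a + 2 * l)) *\<^sub>R u"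
    and "\<exists>u. u \<noteq> 0 \<and> \<eta> x u = 0 \<and> h x u = l *\<^sub>R u"
    and "\<exists>u. u \<noteq> 0 \<and> \<eta> x u = 0 \<and> h x u = (- l) *\<^sub>R u"
proof -
  have s\<psi>: "s (\<psi> u) = \<phi> x u" if "\<eta> x u = 0" for u
    by (rule lifted_structure_anticommute(1)[where y = x])
      (fact x s_ker s_G Q_sym \<psi>_ker \<psi>_sq Q_\<psi> sh that)+
  have s_eq: "\<phi> x (\<psi> u) = - s u" if "\<eta> x u = 0" for u
  proof -
    have "s u = - \<phi> x (\<psi> u)"
      by (rule lifted_structure_anticommute(2)[where y = x])
        (fact x s_ker s_G Q_sym \<psi>_ker \<psi>_sq Q_\<psi> sh that)+
    then show ?thesis by simp
  qed
  have h\<phi>_ker: "\<eta> x (\<phi> x u) = 0" "\<eta> x (h x u) = 0" for u using x by (simp_all add: \<eta>_\<phi> \<eta>_h)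
  have s_lin: "s (r *\<^sub>R u + t *\<^sub>R v) = r *\<^sub>R s u + t *\<^sub>R s v" if "\<eta> x u = 0" "\<eta> x v = 0" for r t u v
  proof (rule ker_eqI[OF x])
    fix z assume z: "\<eta> x z = 0"
    have "G x (s (r *\<^sub>R u + t *\<^sub>R v)) z = G x (s z) (r *\<^sub>R u + t *\<^sub>R v)"
      using that z x by (simp add: s_G Q_sym[of "r *\<^sub>R u + t *\<^sub>R v"] \<eta>_simps)
    also have "\<dots> = r * Q z u + t * Q z v" using that z x by (simp add: s_G G_simps)
    also have "\<dots> = G x (r *\<^sub>R s u + t *\<^sub>R s v) z" using that z x by (simp add: s_G G_simps Q_sym)
    finally show "G x (s (r *\<^sub>R u + t *\<^sub>R v)) z = G x (r *\<^sub>R s u + t *\<^sub>R s v) z" .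
  qed (use that x in \<open>simp_all add: s_ker \<eta>_simps\<close>)
  \<comment> \<open>The vector s (k (\<psi> v)) is evaluated twice: by the formula for
    \<open>k\<close> together with \<phi> \<psi> = - s, and by moving \<psi> past \<open>k\<close>
    and using s \<psi> = \<phi>.\<close>
  have ss: "a *\<^sub>R h x (s (s v)) - (2 * (l * l)) *\<^sub>R s (s v) = a *\<^sub>R h x v + (2 * (l * l)) *\<^sub>R v"
    if v: "\<eta> x v = 0" for v
  proof -
    have kv: "\<eta> x (k v) = 0" using x v by (simp add: k \<eta>_simps h\<phi>_ker)
    have "k (\<psi> v) = a *\<^sub>R h x (s v) + (- (2 * (l * l))) *\<^sub>R s v"
      using v x by (simp add: k \<psi>_ker s_eq h_simps)
    then have "s (k (\<psi> v)) = a *\<^sub>R h x (s (s v)) - (2 * (l * l)) *\<^sub>R s (s v)"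
      using v s_lin[of "h x (s v)" "s v" a "- (2 * (l * l))"] by (simp add: s_ker h\<phi>_ker sh)
    moreover have "s (k (\<psi> v)) = - \<phi> x (k v)"
    proof -
      have "k (\<psi> v) = (- 1) *\<^sub>R \<psi> (k v) + 0 *\<^sub>R \<psi> (k v)" using k_\<psi>[OF v] by simp
      then show ?thesis using s_lin[of "\<psi> (k v)" "\<psi> (k v)" "- 1" 0] s\<psi>[OF kv] kv by (simp add: \<psi>_ker)
    qed
    moreover have "- \<phi> x (k v) = a *\<^sub>R h x v + (2 * (l * l)) *\<^sub>R v"
      using x v by (simp add: k \<phi>_simps \<phi>_sq h_\<phi> \<eta>_h algebra_simps)
    ultimately show ?thesis by simp
  qed
  \<comment> \<open>On an eigenvector of h for e, with \<open>e * e = l * l\<close>, the relation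
    \<open>ss\<close> is divisible by e. Commutation with h keeps s v in the eigenspace.\<close>
  have ev: "(a - 2 * e) *\<^sub>R s (s v) = (a + 2 * e) *\<^sub>R v"
    if v: "\<eta> x v = 0" and e: "h x v = e *\<^sub>R v" "e * e = l * l" for v e
  proof -
    have sv: "h x (s w) = e *\<^sub>R s w" if "\<eta> x w = 0" "h x w = e *\<^sub>R w" for w
      using sh[OF that(1)] that s_lin[of w w e 0] by simp
    have "e *\<^sub>R ((a - 2 * e) *\<^sub>R s (s v)) = e *\<^sub>R ((a + 2 * e) *\<^sub>R v)"
      using ss[OF v, folded e(2)] sv[OF s_ker[OF v] sv[OF v e(1)]] e(1) by (simp add: algebra_simps)
    moreover have "e \<noteq> 0" using e l by auto
    ultimately show ?thesis using scaleR_left_imp_eq by blast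
  qed
  have pos: "G x (s u) u > 0" if "\<eta> x u = 0" "u \<noteq> 0" for u
    using that by (simp add: s_G Q_pos)
  have s_ev: "s v = sqrt ((a + 2 * e) / (a - 2 * e)) *\<^sub>R v"
    if v: "\<eta> x v = 0" and e: "h x v = e *\<^sub>R v" "e * e = l * l" and r: "(a + 2 * e) / (a - 2 * e) > 0" for v e
  proof (rule ccontr)
    define \<sigma> where "\<sigma> = sqrt ((a + 2 * e) / (a - 2 * e))"
    \<comment> \<open>Since s squares to \<sigma> squared on \<open>v\<close>, a nonzero
      \<open>Y\<close> would be an eigenvector of s for - \<sigma>, against the positivity of
      \<open>s\<close>.\<close>
    define Y where "Y = 1 *\<^sub>R s v + (- \<sigma>) *\<^sub>R v"
    assume "s v \<noteq> sqrt ((a + 2 * e) / (a - 2 * e)) *\<^sub>R v"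
    then have Y: "Y \<noteq> 0" by (simp add: Y_def \<sigma>_def)
    have \<sigma>: "\<sigma> > 0" "\<sigma> * \<sigma> = (a + 2 * e) / (a - 2 * e)"
      unfolding \<sigma>_def using r by (simp_all only: real_sqrt_gt_0_iff real_sqrt_mult_self abs_of_pos)
    have Y_ker: "\<eta> x Y = 0" using x v by (simp add: Y_def \<eta>_simps s_ker)
    have nz: "a - 2 * e \<noteq> 0" using r by auto
    then have "(a - 2 * e) *\<^sub>R s (s v) = (a - 2 * e) *\<^sub>R ((\<sigma> * \<sigma>) *\<^sub>R v)"
      using ev[OF v e] by (simp add: \<sigma>(2))
    with nz have ssv: "s (s v) = (\<sigma> * \<sigma>) *\<^sub>R v" using scaleR_left_imp_eq by blast
    have "s Y = s (s v) - \<sigma> *\<^sub>R s v" using s_lin[OF s_ker[OF v] v, of 1 "- \<sigma>"] by (simp add: Y_def)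
    then have "s Y = - \<sigma> *\<^sub>R Y" by (simp add: ssv Y_def algebra_simps)
    then have "G x (s Y) Y = - \<sigma> * G x Y Y" using x by (simp add: G_simps)
    then show False using pos[OF Y_ker Y] mult_pos_pos[OF \<sigma>(1) G_pos[OF x Y]] by simp
  qed
  \<comment> \<open>For any nonzero u in the kernel, (h + e) u is an eigenvector for e unless it
    vanishes. In that case u belongs to - e, and \<phi> u belongs to e because \<phi> anticommutes
    with h.\<close>
  have ex: "\<exists>u. u \<noteq> 0 \<and> \<eta> x u = 0 \<and> h x u = e *\<^sub>R u" if e: "e * e = l * l" for e
  proof -
    obtain u where u: "u \<noteq> 0" "\<eta> x u = 0" using nontriv by blast
    show ?thesis
    proof (cases "h x u + e *\<^sub>R u = 0")
      case True
      then have hu: "h x u = - e *\<^sub>R u" by (simp add: eq_neg_iff_add_eq_0)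
      then have "h x (\<phi> x u) = e *\<^sub>R \<phi> x u" using x by (simp add: h_\<phi> \<phi>_simps)
      moreover have "\<phi> x u \<noteq> 0"
      proof
        assume "\<phi> x u = 0"
        then have "\<phi> x (\<phi> x u) = 0" using x by (simp add: \<phi>_simps)
        then show False using x u by (simp add: \<phi>_sq)
      qed
      ultimately show ?thesis using h\<phi>_ker by blast
    next
      case False
      have "h x (h x u + e *\<^sub>R u) = e *\<^sub>R (h x u + e *\<^sub>R u)"
        using x u e by (simp add: h_simps hh algebra_simps)
      moreover have "\<eta> x (h x u + e *\<^sub>R u) = 0" using x u by (simp add: \<eta>_simps h\<phi>_ker)
      ultimately show ?thesis using False by blast
    qed
  qed
  show ex_l: "\<exists>u. u \<noteq> 0 \<and> \<eta> x u = 0 \<and> h x u = l *\<^sub>R u" by (rule ex) simp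
  show "\<exists>u. u \<noteq> 0 \<and> \<eta> x u = 0 \<and> h x u = (- l) *\<^sub>R u" by (rule ex) simp
  show al: "\<bar>a\<bar> > 2 * l"
  proof (rule ccontr)
    obtain v where v: "v \<noteq> 0" "\<eta> x v = 0" "h x v = l *\<^sub>R v" using ex_l by blast
    have "s v \<noteq> 0" using pos[OF v(2,1)] x by (auto simp: G_simps)
    then have p: "G x (s v) (s v) > 0" by (rule G_pos[OF x])
    \<comment> \<open>Pairing \<open>ev\<close> with v compares G(s v, s v) and G(v, v), both
      positive. If |a| were at most 2 l, the two sides would have opposite weak signs, so a - 2 l
      and a + 2 l would both be 0.\<close>
    have "(a - 2 * l) * G x (s (s v)) v = (a + 2 * l) * G x v v"
      using arg_cong[OF ev[OF v(2,3)], of "\<lambda>w. G x w v"] x by (simp add: G_simps)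
    moreover have "G x (s (s v)) v = G x (s v) (s v)"
      using v by (simp add: s_G s_ker Q_sym[of "s v" v])
    ultimately have eq: "(a - 2 * l) * G x (s v) (s v) = (a + 2 * l) * G x v v" by simp
    assume "\<not> \<bar>a\<bar> > 2 * l"
    then have a: "a - 2 * l \<le> 0" "a + 2 * l \<ge> 0" by auto
    have "(a - 2 * l) * G x (s v) (s v) \<le> 0" using a p by (simp add: mult_nonpos_nonneg)
    moreover have "(a + 2 * l) * G x v v \<ge> 0" using a G_pos[OF x v(1)] by simp
    ultimately have "(a - 2 * l) * G x (s v) (s v) = 0" "(a + 2 * l) * G x v v = 0" using eq by auto
    then have "a - 2 * l = 0" "a + 2 * l = 0" using p G_pos[OF x v(1)] by auto
    then show False using l by simp
  qed
  have "(a + 2 * l) / (a - 2 * l) > 0" "(a - 2 * l) / (a + 2 * l) > 0"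
    using al l by (auto simp: zero_less_divide_iff abs_if split: if_splits)
  then show "\<eta> x u = 0 \<Longrightarrow> h x u = l *\<^sub>R u \<Longrightarrow> s u = sqrt ((a + 2 * l) / (a - 2 * l)) *\<^sub>R u"
    "\<eta> x u = 0 \<Longrightarrow> h x u = (- l) *\<^sub>R u \<Longrightarrow> s u = sqrt ((a - 2 * l) / (a + 2 * l)) *\<^sub>R u"
    using s_ev[of u l] s_ev[of u "- l"] by simp_all
qed

end

section \<open>Charts adapted to the Reeb flow\<close>

text \<open>Of the cubical charts provided by regularity, the constant Reeb vector and the convexity
  of the range are retained. Convexity makes the times at which a Reeb line lies in the chart an
  interval.\<close>

locale regular_chart =
  fixes A :: "('m::{t2_space, second_countable_topology}, 'e::euclidean_space) chart set"
    and B :: "('b::{t2_space, second_countable_topology}, 'f::euclidean_space) chart set"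
    and n :: nat
    and \<eta> :: "('m, 'e) form1" and \<xi> :: "('m, 'e) vfield" and g\<^sub>M :: "('m, 'e) form2"
    and \<phi> h :: "('m, 'e) endo" and \<kappa> \<mu> :: real
    and \<theta> :: "real \<Rightarrow> 'm \<Rightarrow> 'm" and \<pi> :: "'m \<Rightarrow> 'b" and \<omega> :: "('b, 'f) form2"
    and c :: "('m, 'e) chart" and e\<^sub>0 :: 'e
  assumes M: "kappa_mu_manifold A n \<eta> \<xi> g\<^sub>M \<phi> h \<kappa> \<mu>"
    and flow: "is_flow A \<xi> \<theta>"
    and fibration: "boothby_wang A B n \<eta> \<theta> \<pi> \<omega>"
    and c: "c \<in> A"
    and convex_ran: "convex (chart_ran c)"
    and \<xi>_c: "q \<in> chart_dom c \<Longrightarrow> \<xi> q c = e\<^sub>0"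
begin

abbreviation "S \<equiv> chart_ran c"
abbreviation "pt \<equiv> chart_inv c"
abbreviation "tv y \<equiv> tvec_of A c (pt y)"

lemma contact: "contact_metric_manifold A n \<eta> \<xi> g\<^sub>M \<phi>" "is_contact_h A \<xi> \<phi> h"
  using M by (auto simp: kappa_mu_manifold_def)

lemma smooth_A: "smooth_structure A" and dim_e: "DIM('e) = 2 * n + 1"
  and one_form: "one_form A \<eta>" and reeb: "reeb_field A \<eta> \<xi>" and metric: "riemannian_metric A g\<^sub>M"
  and endo: "endo_field A \<phi>" "endo_field A h"
  and \<eta>_metric: "v \<in> tangent_space A p \<Longrightarrow> \<eta> p v = g\<^sub>M p (\<xi> p) v"
  and \<phi>_sq_tangent: "v \<in> tangent_space A p \<Longrightarrow> \<phi> p (\<phi> p v) = - v + \<eta> p v *\<^sub>R \<xi> p"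
  and d\<eta>_metric: "is_ext_deriv A \<eta> (\<lambda>p u v. g\<^sub>M p u (\<phi> p v))"
  using contact by (simp_all add: contact_metric_manifold_def contact_form_def is_contact_h_def)

lemma smooth_B: "smooth_structure B" and dim_f: "DIM('f) = 2 * n"
  and symplectic: "symplectic_form B \<omega>" and d\<eta>_pullback: "is_ext_deriv A \<eta> (pullback2 A B \<pi> \<omega>)"
  and \<pi>_smooth: "smooth_map_on A B UNIV \<pi>" and \<pi>_flow: "\<pi> (\<theta> t p) = \<pi> p"
proof -
  from fibration obtain \<tau> where *: "principal_circle_bundle A B \<theta> \<tau> \<pi>"
    and **: "smooth_structure B" "DIM('f) = 2 * n" "symplectic_form B \<omega>"
      "is_ext_deriv A \<eta> (pullback2 A B \<pi> \<omega>)"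
    by (auto simp: boothby_wang_def)
  show "smooth_structure B" "DIM('f) = 2 * n" "symplectic_form B \<omega>"
      "is_ext_deriv A \<eta> (pullback2 A B \<pi> \<omega>)"
    by (fact **)+
  show "smooth_map_on A B UNIV \<pi>" using * by (simp add: principal_circle_bundle_def)
  have "\<forall>p q. \<pi> p = \<pi> q \<longleftrightarrow> (\<exists>t. q = \<theta> t p)" using * by (simp add: principal_circle_bundle_def)
  then show "\<pi> (\<theta> t p) = \<pi> p" by metis
qed

section \<open>Flow lines and the differential of the projection in an adapted chart\<close>

lemma chart: "is_chart c"
  by (rule atlas_chart[OF smooth_A c])

lemma open_ran: "open S"
  using chart by (simp add: is_chart_def)

lemma c_at: "y \<in> S \<Longrightarrow> c \<in> charts_at A (pt y)"
  using c chart_inv_in[OF chart] by (simp add: charts_at_def)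

lemma tv_in: "y \<in> S \<Longrightarrow> tv y u \<in> tangent_space A (pt y)"
  by (rule tvec_of_in[OF smooth_A c_at])

lemma tv_c [simp]: "y \<in> S \<Longrightarrow> tv y u c = u"
  by (rule tvec_of_self[OF smooth_A c_at])

lemma tv_coord: "y \<in> S \<Longrightarrow> v \<in> tangent_space A (pt y) \<Longrightarrow> tv y (v c) = v"
  by (rule tvec_of_coord[OF smooth_A c_at])

lemma endo_in: "v \<in> tangent_space A p \<Longrightarrow> \<phi> p v \<in> tangent_space A p"
  "v \<in> tangent_space A p \<Longrightarrow> h p v \<in> tangent_space A p"
  using endo unfolding endo_field_def by blast+

lemma tv_endo:
  assumes "y \<in> S"
  shows "tv y (rep_endo A c \<phi> y u) = \<phi> (pt y) (tv y u)"
    and "tv y (rep_endo A c h y u) = h (pt y) (tv y u)"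
  unfolding rep_endo_def using assms by (simp_all add: tv_coord endo_in tv_in)

lemma \<xi>_in: "\<xi> p \<in> tangent_space A p"
  using reeb by (simp add: reeb_field_def vector_field_def)

lemma \<eta>_\<xi>: "\<eta> p (\<xi> p) = 1"
  using reeb by (simp add: reeb_field_def)

lemma tv_e0: assumes "y \<in> S" shows "tv y e\<^sub>0 = \<xi> (pt y)"
  using tv_coord[OF assms \<xi>_in] \<xi>_c[OF chart_inv_in[OF chart assms]] by simp

lemma rep_\<xi>: "y \<in> S \<Longrightarrow> rep_vf c \<xi> y = e\<^sub>0"
  unfolding rep_vf_def by (rule \<xi>_c[OF chart_inv_in[OF chart]])

text \<open>While an orbit stays in the chart, its coordinate minus t times \<open>e\<^sub>0\<close>
  has zero derivative, so the flow is translation. This is local in time, since an orbit may leave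
  the chart and return.\<close>

lemma flow_in_chart:
  assumes y: "y \<in> S"
  shows "\<exists>\<epsilon>>0. \<forall>t. \<bar>t\<bar> < \<epsilon> \<longrightarrow> y + t *\<^sub>R e\<^sub>0 \<in> S \<and> \<theta> t (pt y) = pt (y + t *\<^sub>R e\<^sub>0)"
proof -
  define q where "q = pt y"
  have q: "q \<in> chart_dom c" "chart_map c q = y"
    using chart_inv_in[OF chart y] chart_map_inv[OF chart y] by (auto simp: q_def)
  have "continuous_on UNIV (\<lambda>t. \<theta> t q)" "\<theta> 0 q = q" using flow by (auto simp: is_flow_def)
  moreover have "open (chart_dom c)" using chart by (simp add: is_chart_def)
  ultimately have "open ((\<lambda>t. \<theta> t q) -` chart_dom c)" "0 \<in> (\<lambda>t. \<theta> t q) -` chart_dom c"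
    using q by (auto simp: continuous_on_open_vimage)
  then obtain \<epsilon> where \<epsilon>: "\<epsilon> > 0" "\<And>t. dist t 0 < \<epsilon> \<Longrightarrow> t \<in> (\<lambda>t. \<theta> t q) -` chart_dom c"
    unfolding open_dist by blast
  note \<epsilon> = \<epsilon>(1) \<epsilon>(2)[unfolded vimage_eq dist_real_def diff_0_right]
  define \<gamma> where "\<gamma> t = chart_map c (\<theta> t q) - t *\<^sub>R e\<^sub>0" for t
  have "(\<gamma> has_vector_derivative 0) (at t)" if "\<bar>t\<bar> < \<epsilon>" for t
  proof -
    have "c \<in> charts_at A (\<theta> t q)" using \<epsilon>(2)[OF that] c by (simp add: charts_at_def)
    then have "((\<lambda>s. chart_map c (\<theta> s q)) has_vector_derivative e\<^sub>0) (at t)"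
      using flow \<xi>_c[OF \<epsilon>(2)[OF that]] unfolding is_flow_def by metis
    then show ?thesis unfolding \<gamma>_def by (auto intro!: derivative_eq_intros)
  qed
  then have \<gamma>': "(\<gamma> has_vector_derivative 0) (at t within {-\<epsilon><..<\<epsilon>})" if "t \<in> {-\<epsilon><..<\<epsilon>}" for t
    using that by (simp add: abs_less_iff has_vector_derivative_at_within)
  obtain k where "\<And>t. t \<in> {-\<epsilon><..<\<epsilon>} \<Longrightarrow> \<gamma> t = k"
    by (rule has_vector_derivative_zero_constant[OF _ \<gamma>']) auto
  then have k: "\<gamma> t = k" if "\<bar>t\<bar> < \<epsilon>" for t using that by (simp add: abs_less_iff)
  have "k = y" using k[of 0] \<epsilon>(1) q \<open>\<theta> 0 q = q\<close> by (simp add: \<gamma>_def)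
  then have eq: "chart_map c (\<theta> t q) = y + t *\<^sub>R e\<^sub>0" if "\<bar>t\<bar> < \<epsilon>" for t
    using k[OF that] by (simp add: \<gamma>_def diff_eq_eq)
  have "y + t *\<^sub>R e\<^sub>0 \<in> S \<and> \<theta> t q = pt (y + t *\<^sub>R e\<^sub>0)" if "\<bar>t\<bar> < \<epsilon>" for t
    unfolding eq[OF that, symmetric]
    using chart_map_in[OF \<epsilon>(2)[OF that]] chart_inv_map[OF chart \<epsilon>(2)[OF that]] by simp
  then show ?thesis using \<epsilon>(1) unfolding q_def by blast
qed

lemma line_in_ran: "y \<in> S \<Longrightarrow> \<exists>\<epsilon>>0. \<forall>t. \<bar>t\<bar> < \<epsilon> \<longrightarrow> y + t *\<^sub>R e\<^sub>0 \<in> S"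
  using flow_in_chart by blast

lemma line_preimage:
  shows "convex {t. y + t *\<^sub>R e\<^sub>0 \<in> S}" and "open {t. y + t *\<^sub>R e\<^sub>0 \<in> S}"
proof -
  show "open {t. y + t *\<^sub>R e\<^sub>0 \<in> S}"
  proof -
    have "continuous_on UNIV (\<lambda>t. y + t *\<^sub>R e\<^sub>0)" by (intro continuous_intros)
    from open_vimage[OF open_ran this] show ?thesis by (simp add: vimage_def)
  qed
  show "convex {t. y + t *\<^sub>R e\<^sub>0 \<in> S}"
  proof (rule convexI)
    fix s t u v :: real
    assume *: "s \<in> {t. y + t *\<^sub>R e\<^sub>0 \<in> S}" "t \<in> {t. y + t *\<^sub>R e\<^sub>0 \<in> S}" "0 \<le> u" "0 \<le> v" "u + v = 1"
    then have "u *\<^sub>R (y + s *\<^sub>R e\<^sub>0) + v *\<^sub>R (y + t *\<^sub>R e\<^sub>0) \<in> S"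
      using convexD[OF convex_ran] by blast
    moreover have "u *\<^sub>R (y + s *\<^sub>R e\<^sub>0) + v *\<^sub>R (y + t *\<^sub>R e\<^sub>0) = (u + v) *\<^sub>R y + (u * s + v * t) *\<^sub>R e\<^sub>0"
      by (simp add: algebra_simps)
    ultimately show "u *\<^sub>R s + v *\<^sub>R t \<in> {t. y + t *\<^sub>R e\<^sub>0 \<in> S}" using *(5) by simp
  qed
qed

text \<open>The projection is invariant under the flow, hence locally constant along the coordinate
  line by \<open>flow_in_chart\<close>; connectedness of the time interval does the rest.\<close>

lemma \<pi>_const:
  assumes y: "y \<in> S" "y + t *\<^sub>R e\<^sub>0 \<in> S"
  shows "\<pi> (pt (y + t *\<^sub>R e\<^sub>0)) = \<pi> (pt y)"
proof -
  let ?I = "{t. y + t *\<^sub>R e\<^sub>0 \<in> S}"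
  have "(\<lambda>t. \<pi> (pt (y + t *\<^sub>R e\<^sub>0))) constant_on ?I"
  proof (rule locally_constant_imp_constant[OF convex_connected[OF line_preimage(1)]])
    fix a assume "a \<in> ?I"
    then obtain \<epsilon> where \<epsilon>: "\<epsilon> > 0" "\<And>s. \<bar>s\<bar> < \<epsilon> \<Longrightarrow>
        \<theta> s (pt (y + a *\<^sub>R e\<^sub>0)) = pt ((y + a *\<^sub>R e\<^sub>0) + s *\<^sub>R e\<^sub>0)"
      using flow_in_chart[of "y + a *\<^sub>R e\<^sub>0"] by auto
    have "\<pi> (pt (y + s *\<^sub>R e\<^sub>0)) = \<pi> (pt (y + a *\<^sub>R e\<^sub>0))" if "s \<in> ball a \<epsilon>" for s
    proof -
      have "pt (y + s *\<^sub>R e\<^sub>0) = \<theta> (s - a) (pt (y + a *\<^sub>R e\<^sub>0))"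
        using \<epsilon>(2)[of "s - a"] that by (simp add: dist_real_def abs_minus_commute algebra_simps)
      then show ?thesis by (simp add: \<pi>_flow)
    qed
    then have "\<forall>x\<in>?I \<inter> ball a \<epsilon>. \<pi> (pt (y + x *\<^sub>R e\<^sub>0)) = \<pi> (pt (y + a *\<^sub>R e\<^sub>0))"
      by blast
    moreover have "openin (top_of_set ?I) (?I \<inter> ball a \<epsilon>)" by (rule openin_open_Int) simp
    moreover have "a \<in> ?I \<inter> ball a \<epsilon>" using \<epsilon>(1) \<open>a \<in> ?I\<close> by simp
    ultimately show "\<exists>T. openin (top_of_set ?I) T \<and> a \<in> T \<and>
        (\<forall>x\<in>T. \<pi> (pt (y + x *\<^sub>R e\<^sub>0)) = \<pi> (pt (y + a *\<^sub>R e\<^sub>0)))"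
      by blast
  qed
  then obtain k where "\<forall>t\<in>?I. \<pi> (pt (y + t *\<^sub>R e\<^sub>0)) = k" by (auto simp: constant_on_def)
  from this[rule_format, of t] this[rule_format, of 0] y show ?thesis by simp
qed

definition d\<pi> :: "'e \<Rightarrow> 'e \<Rightarrow> ('b, 'f) tvec" where
  "d\<pi> y u = tangent_map A B \<pi> (pt y) (tv y u)"

lemma d\<pi>_chart:
  assumes y: "y \<in> S" and d: "d \<in> charts_at B (\<pi> (pt y))"
  shows "(chart_map d \<circ> \<pi> \<circ> pt) differentiable (at y)"
    and "d\<pi> y u = tvec_of B d (\<pi> (pt y)) (dird (chart_map d \<circ> \<pi> \<circ> pt) y u)"
  using tangent_map_in_charts[OF smooth_A smooth_B \<pi>_smooth c_at[OF y] d tv_in[OF y]] y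
  by (simp_all add: d\<pi>_def chart_map_inv[OF chart])

lemma d\<pi>_const:
  assumes y: "y \<in> S" "y + t *\<^sub>R e\<^sub>0 \<in> S"
  shows "d\<pi> (y + t *\<^sub>R e\<^sub>0) u = d\<pi> y u"
proof -
  obtain d where d: "d \<in> charts_at B (\<pi> (pt y))" using charts_at_nonempty[OF smooth_B] by blast
  have d': "d \<in> charts_at B (\<pi> (pt (y + t *\<^sub>R e\<^sub>0)))" using d \<pi>_const[OF y] by simp
  let ?F = "chart_map d \<circ> \<pi> \<circ> pt"
  have "((\<lambda>z. z + t *\<^sub>R e\<^sub>0) has_derivative (\<lambda>u. u)) (at y)"
    by (auto intro!: derivative_eq_intros)
  then have "((\<lambda>z. ?F (z + t *\<^sub>R e\<^sub>0)) has_derivative dird ?F (y + t *\<^sub>R e\<^sub>0)) (at y)"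
    by (rule has_derivative_compose[where g = ?F])
      (rule dird_has_derivative[OF d\<pi>_chart(1)[OF y(2) d']])
  then have "dird (\<lambda>z. ?F (z + t *\<^sub>R e\<^sub>0)) y u = dird ?F (y + t *\<^sub>R e\<^sub>0) u"
    by (rule dird_eqI)
  moreover have "dird (\<lambda>z. ?F (z + t *\<^sub>R e\<^sub>0)) y u = dird ?F y u"
  proof (rule dird_cong)
    \<comment> \<open>Where both the point and its translate lie in the chart range,
      \<open>\<pi>_const\<close> identifies the two functions.\<close>
    show "open (S \<inter> (\<lambda>z. z + t *\<^sub>R e\<^sub>0) -` S)"
      by (intro open_Int open_ran open_vimage continuous_intros)
  qed (use y \<pi>_const in auto)
  ultimately show ?thesis
    using d\<pi>_chart(2)[OF y(1) d] d\<pi>_chart(2)[OF y(2) d'] \<pi>_const[OF y] by simp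
qed

text \<open>The two descriptions of d\<eta>, through the metric and through \<omega>. The second
  makes its invariance along the flow visible.\<close>

lemma \<Omega>_pullback:
  assumes "y \<in> S"
  shows "rep2 A c g\<^sub>M y u (rep_endo A c \<phi> y v) = ext_d1 (rep1 A c \<eta>) y u v"
    and "ext_d1 (rep1 A c \<eta>) y u v = \<omega> (\<pi> (pt y)) (d\<pi> y u) (d\<pi> y v)"
proof -
  have "rep2 A c (\<lambda>p u v. g\<^sub>M p u (\<phi> p v)) y u v = ext_d1 (rep1 A c \<eta>) y u v"
    using d\<eta>_metric c assms unfolding is_ext_deriv_def by blast
  then show "rep2 A c g\<^sub>M y u (rep_endo A c \<phi> y v) = ext_d1 (rep1 A c \<eta>) y u v"
    by (simp add: rep2_def tv_endo(1)[OF assms])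
  have "rep2 A c (pullback2 A B \<pi> \<omega>) y u v = ext_d1 (rep1 A c \<eta>) y u v"
    using d\<eta>_pullback c assms unfolding is_ext_deriv_def by blast
  then show "ext_d1 (rep1 A c \<eta>) y u v = \<omega> (\<pi> (pt y)) (d\<pi> y u) (d\<pi> y v)"
    by (simp add: rep2_def pullback2_def d\<pi>_def)
qed

sublocale reeb_coords S e\<^sub>0 "rep2 A c g\<^sub>M" "rep1 A c \<eta>" "rep_endo A c \<phi>" "rep_endo A c h"
proof (rule reeb_coords.intro)
  show "open S" by (rule open_ran)
  have bil: "bilinear_field A g\<^sub>M"
    and sym: "\<And>p u v. u \<in> tangent_space A p \<Longrightarrow> v \<in> tangent_space A p \<Longrightarrow> g\<^sub>M p u v = g\<^sub>M p v u"
    and pos: "\<And>p u. u \<in> tangent_space A p \<Longrightarrow> u \<noteq> 0 \<Longrightarrow> g\<^sub>M p u u > 0"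
    using metric by (auto simp: riemannian_metric_def)
  have G_lin: "linear (rep2 A c g\<^sub>M y u)" if "y \<in> S" for y u
    unfolding rep2_def using bil tv_in[OF that]
    by (intro linear_on_set_tvec_of[OF smooth_A c_at[OF that]]) (auto simp: bilinear_field_def)
  have G_diff: "(\<lambda>y. rep2 A c g\<^sub>M y u v) differentiable (at y)" if "y \<in> S" for y u v
    using bil that c by (intro smooth_on_differentiable[of S]) (auto simp: bilinear_field_def)
  have endo_lin: "linear (rep_endo A c \<phi> y)" "linear (rep_endo A c h y)" if "y \<in> S" for y
  proof -
    have l: "linear_on_set (tangent_space A (pt y)) (\<phi> (pt y))"
      "linear_on_set (tangent_space A (pt y)) (h (pt y))"
      using endo unfolding endo_field_def by blast+
    show "linear (rep_endo A c \<phi> y)" "linear (rep_endo A c h y)"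
      unfolding rep_endo_def
      by (rule linear_eval[OF linear_on_set_tvec_of[OF smooth_A c_at[OF that] l(1)]]
          linear_eval[OF linear_on_set_tvec_of[OF smooth_A c_at[OF that] l(2)]])+
  qed
  have endo_diff: "(\<lambda>y. rep_endo A c \<phi> y u) differentiable (at y)"
    "(\<lambda>y. rep_endo A c h y u) differentiable (at y)" if "y \<in> S" for y u
    using endo that c by (auto intro!: smooth_on_differentiable[of S] simp: endo_field_def)
  fix y u v assume y: "y \<in> S"
  show "linear (rep2 A c g\<^sub>M y u)" by (rule G_lin[OF y])
  show "(\<lambda>y. rep2 A c g\<^sub>M y u v) differentiable (at y)" by (rule G_diff[OF y])
  show "linear (rep_endo A c \<phi> y)" "linear (rep_endo A c h y)" by (rule endo_lin[OF y])+
  show "(\<lambda>y. rep_endo A c \<phi> y u) differentiable (at y)"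
    "(\<lambda>y. rep_endo A c h y u) differentiable (at y)" by (rule endo_diff[OF y])+
  show "rep2 A c g\<^sub>M y u v = rep2 A c g\<^sub>M y v u"
    unfolding rep2_def by (rule sym) (rule tv_in[OF y])+
  have "tv y u \<noteq> 0" if "u \<noteq> 0"
    using that tv_c[OF y, of u] by (metis zero_fun_apply)
  then show "u \<noteq> 0 \<Longrightarrow> rep2 A c g\<^sub>M y u u > 0"
    unfolding rep2_def by (intro pos tv_in[OF y])
  show "rep1 A c \<eta> y v = rep2 A c g\<^sub>M y e\<^sub>0 v"
    unfolding rep1_def rep2_def by (simp add: tv_e0 y \<eta>_metric tv_in)
  show "rep1 A c \<eta> y e\<^sub>0 = 1"
    unfolding rep1_def by (simp add: tv_e0 y \<eta>_\<xi>)
  show "rep_endo A c \<phi> y (rep_endo A c \<phi> y v) = - v + rep1 A c \<eta> y v *\<^sub>R e\<^sub>0"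
    unfolding rep_endo_def[of _ _ _ y "rep_endo A c \<phi> y v"] tv_endo[OF y] rep1_def
    using y by (simp add: \<phi>_sq_tangent tv_in scaleR_fun_def \<xi>_c chart_inv_in[OF chart])
  show "rep2 A c g\<^sub>M y u (rep_endo A c \<phi> y v) = ext_d1 (rep1 A c \<eta>) y u v"
    by (rule \<Omega>_pullback(1)[OF y])
  show "ext_d1 (rep1 A c \<eta>) y e\<^sub>0 v = 0"
    using reeb c y rep_\<xi>[OF y] unfolding reeb_field_def by metis
  show "dird (\<lambda>y. rep2 A c g\<^sub>M y u (rep_endo A c \<phi> y v)) y e\<^sub>0 = 0"
  proof -
    obtain \<epsilon> where \<epsilon>: "\<epsilon> > 0" "\<And>t. \<bar>t\<bar> < \<epsilon> \<Longrightarrow> y + t *\<^sub>R e\<^sub>0 \<in> S"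
      using line_in_ran[OF y] by blast
    show ?thesis
    \<comment> \<open>By \<open>\<Omega>_pullback\<close> the form is \<omega> at a fixed base
      point, evaluated on images under d\<pi> that do not change along the line.\<close>
    proof (rule dird_zero_if_constant_on_line[OF _ \<epsilon>(1)])
      show "(\<lambda>y. rep2 A c g\<^sub>M y u (rep_endo A c \<phi> y v)) differentiable (at y)"
        by (rule dird_apply(1)[OF open_ran y G_lin G_diff[OF y] endo_diff(1)[OF y]])
    qed (simp add: \<Omega>_pullback y \<epsilon>(2) \<pi>_const d\<pi>_const)
  qed
  show "dird (\<lambda>y. rep_endo A c \<phi> y u) y e\<^sub>0 = 2 *\<^sub>R rep_endo A c h y u"
  proof -
    have "dird (rep_vf c \<xi>) y w = 0" for w
      by (rule dird_const_near[OF open_ran y rep_\<xi>])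
    then have "lie_endo (rep_vf c \<xi>) (rep_endo A c \<phi>) y u = dird (\<lambda>y. rep_endo A c \<phi> y u) y e\<^sub>0"
      using linear_0[OF endo_lin(1)] y
      by (simp add: lie_endo_def vf_bracket_def rep_\<xi> frechet_derivative_const)
    moreover have "rep_endo A c h y u = (1/2) *\<^sub>R lie_endo (rep_vf c \<xi>) (rep_endo A c \<phi>) y u"
      using contact(2) c y by (simp add: is_contact_h_def)
    ultimately show ?thesis by simp
  qed
qed

abbreviation "\<eta>\<^sub>c \<equiv> rep1 A c \<eta>"

lemma ker_iff: "y \<in> S \<Longrightarrow> \<eta>\<^sub>c y u = 0 \<longleftrightarrow> tv y u \<in> ker_form A \<eta> (pt y)"
  by (simp add: rep1_def ker_form_def tv_in)

text \<open>Integrates \<open>\<eta>_const\<close> over the time interval. Thus the kernel is the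
  same coordinate subspace along a Reeb line, and a lift built at one point acts on it at all of
  them.\<close>

lemma \<eta>\<^sub>c_const:
  assumes y: "y \<in> S" "y + t *\<^sub>R e\<^sub>0 \<in> S"
  shows "\<eta>\<^sub>c (y + t *\<^sub>R e\<^sub>0) u = \<eta>\<^sub>c y u"
proof -
  let ?I = "{t. y + t *\<^sub>R e\<^sub>0 \<in> S}"
  have "((\<lambda>t. \<eta>\<^sub>c (y + t *\<^sub>R e\<^sub>0) u) has_vector_derivative 0) (at t within ?I)" if "t \<in> ?I" for t
  proof -
    have z: "y + t *\<^sub>R e\<^sub>0 \<in> S" using that by simp
    have "((\<lambda>t. y + t *\<^sub>R e\<^sub>0) has_derivative (\<lambda>t. t *\<^sub>R e\<^sub>0)) (at t)"
      by (auto intro!: derivative_eq_intros)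
    then have "((\<lambda>t. \<eta>\<^sub>c (y + t *\<^sub>R e\<^sub>0) u) has_derivative (\<lambda>s. dird (\<lambda>y. \<eta>\<^sub>c y u) (y + t *\<^sub>R e\<^sub>0) (s *\<^sub>R e\<^sub>0))) (at t)"
      by (rule has_derivative_compose[where g = "\<lambda>y. \<eta>\<^sub>c y u"]) (rule dird_has_derivative[OF \<eta>_diff[OF z]])
    then show ?thesis
      by (simp add: has_vector_derivative_def linear_scale[OF linear_dird[OF \<eta>_diff[OF z]]]
          \<eta>_const[OF z] has_derivative_at_withinI)
  qed
  then obtain k where k: "\<And>t. t \<in> ?I \<Longrightarrow> \<eta>\<^sub>c (y + t *\<^sub>R e\<^sub>0) u = k"
    using has_vector_derivative_zero_constant[OF line_preimage(1)] by blast
  from k[of t] k[of 0] y show ?thesis by simp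
qed

section \<open>The contact distribution as a copy of the tangent space of the base\<close>

lemma d\<pi>_in: "y \<in> S \<Longrightarrow> d\<pi> y u \<in> tangent_space B (\<pi> (pt y))"
  using charts_at_nonempty[OF smooth_B] d\<pi>_chart(2) tvec_of_in[OF smooth_B] by metis

lemma d\<pi>_lin:
  assumes y: "y \<in> S"
  shows "d\<pi> y (a *\<^sub>R u + b *\<^sub>R v) = a *\<^sub>R d\<pi> y u + b *\<^sub>R d\<pi> y v"
proof -
  obtain d where d: "d \<in> charts_at B (\<pi> (pt y))" using charts_at_nonempty[OF smooth_B] by blast
  note l = linear_dird[OF d\<pi>_chart(1)[OF y d]]
  show ?thesis unfolding d\<pi>_chart(2)[OF y d]
    by (simp add: linear_add[OF l] linear_scale[OF l] tvec_of_lin[OF smooth_B d])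
qed

lemma zero_in: "(0 :: ('b, 'f) tvec) \<in> tangent_space B b"
proof -
  obtain d where d: "d \<in> charts_at B b" using charts_at_nonempty[OF smooth_B] by blast
  have v: "tvec_of B d b 0 \<in> tangent_space B b" by (rule tvec_of_in[OF smooth_B d])
  then show ?thesis using tangent_space_lin[OF smooth_B v v, of 0 0] by simp
qed

text \<open>If d\<pi> u = 0, then d\<eta>(u, \<phi> u) = 0 because d\<eta> is pulled back. For u in
  the kernel of \<eta> that value is - G(u, u).\<close>

lemma d\<pi>_kernel:
  assumes y: "y \<in> S" and u: "\<eta>\<^sub>c y u = 0" "d\<pi> y u = 0"
  shows "u = 0"
proof (rule ccontr)
  have \<omega>_lin: "linear_on_set (tangent_space B b) (\<lambda>v. \<omega> b v w)" if "w \<in> tangent_space B b" for b w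
    using symplectic that by (simp add: symplectic_form_def bilinear_field_def)
  assume "u \<noteq> 0"
  have "\<omega> (\<pi> (pt y)) 0 w = 0" if "w \<in> tangent_space B (\<pi> (pt y))" for w
    using linear_on_setD[OF \<omega>_lin[OF that] zero_in zero_in, of 0 0] by simp
  then have "rep2 A c g\<^sub>M y u (rep_endo A c \<phi> y (rep_endo A c \<phi> y u)) = 0"
    unfolding \<Omega>_pullback[OF y] u(2) by (simp add: d\<pi>_in y)
  then have "rep2 A c g\<^sub>M y u u = 0" using y u by (simp add: \<phi>_sq G_simps)
  then show False using G_pos[OF y \<open>u \<noteq> 0\<close>] by simp
qed

text \<open>\<open>R\<close> is the horizontal lift in coordinates. d\<pi> is injective on the
  kernel by \<open>d\<pi>_kernel\<close>, and both spaces have dimension 2n.\<close>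

lemma d\<pi>_iso:
  assumes y: "y \<in> S" and d: "d \<in> charts_at B (\<pi> (pt y))"
  obtains R :: "'f \<Rightarrow> 'e" where "linear R" "\<And>w. \<eta>\<^sub>c y (R w) = 0"
    "\<And>w. d\<pi> y (R w) = tvec_of B d (\<pi> (pt y)) w"
    "\<And>u. \<eta>\<^sub>c y u = 0 \<Longrightarrow> R (d\<pi> y u d) = u"
proof -
  define K where "K = {u. \<eta>\<^sub>c y u = 0}"
  define P where "P = dird (chart_map d \<circ> \<pi> \<circ> pt) y"
  have P: "linear P" unfolding P_def by (rule linear_dird[OF d\<pi>_chart(1)[OF y d]])
  have d\<pi>_P: "d\<pi> y u = tvec_of B d (\<pi> (pt y)) (P u)" for u
    unfolding P_def by (rule d\<pi>_chart(2)[OF y d])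
  have P_d\<pi>: "P u = d\<pi> y u d" for u
    by (simp add: d\<pi>_P tvec_of_self[OF smooth_B d])
  have K: "subspace K" using y by (auto simp: K_def subspace_def \<eta>_simps)
  have inj: "inj_on P K"
  proof (rule linear_inj_on_iff_eq_0[OF P K, THEN iffD2], intro ballI impI)
    fix u assume u: "u \<in> K" "P u = 0"
    have "d\<pi> y u = 0"
      by (rule tvec_eqI[OF smooth_B d d\<pi>_in[OF y] zero_in]) (use u in \<open>simp add: P_d\<pi>\<close>)
    then show "u = 0" using u d\<pi>_kernel[OF y] by (simp add: K_def)
  qed
  \<comment> \<open>The vector representing \<eta> in the Euclidean inner product, so that
    \<open>K\<close> is a hyperplane.\<close>
  define z where "z = adjoint (\<eta>\<^sub>c y) 1"
  have z: "\<eta>\<^sub>c y u = z \<bullet> u" for u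
    using adjoint_works[OF \<eta>_lin[OF y], of u 1] by (simp add: z_def inner_commute)
  have "z \<noteq> 0" using z[of e\<^sub>0] y by (auto simp: \<eta>_e0)
  then have "dim K = 2 * n" using dim_hyperplane[of z] dim_e by (simp add: K_def z)
  moreover have "dim (P ` K) = dim K"
    by (rule dim_image_eq[OF P]) (use inj K in \<open>simp add: span_eq_iff[THEN iffD2]\<close>)
  ultimately have "dim (P ` K) = DIM('f)" using dim_f by simp
  then have surj: "P ` K = UNIV"
    using linear_subspace_image[OF P K] by (metis dim_eq_full span_eq_iff)
  obtain R where R: "range R \<subseteq> K" "linear R" "\<forall>v\<in>K. R (P v) = v"
    using linear_exists_left_inverse_on[OF P K inj] by blast
  have PR: "P (R w) = w" for w
  proof -
    obtain v where "v \<in> K" "w = P v" using surj by blast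
    then show ?thesis using R by simp
  qed
  show ?thesis
  proof
    show "linear R" by (rule R(2))
    show "\<eta>\<^sub>c y (R w) = 0" for w using R(1) by (auto simp: K_def)
    show "d\<pi> y (R w) = tvec_of B d (\<pi> (pt y)) w" for w by (simp add: d\<pi>_P PR)
    show "R (d\<pi> y u d) = u" if "\<eta>\<^sub>c y u = 0" for u using R(3) that by (simp add: K_def flip: P_d\<pi>)
  qed
qed

text \<open>\<psi> is d\<pi>, then \<open>J\<close>, then the horizontal lift \<open>R\<close>. This
  is a linear map of the whole coordinate space with image in the kernel, as
  \<open>dird_h_anticommute\<close> requires.\<close>

lemma lifted_complex_structure:
  assumes y: "y \<in> S" and J: "almost_complex_structure B J"
  obtains \<psi> where "linear \<psi>" "\<And>u. \<eta>\<^sub>c y (\<psi> u) = 0"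
    "\<And>u. \<eta>\<^sub>c y u = 0 \<Longrightarrow> d\<pi> y (\<psi> u) = J (\<pi> (pt y)) (d\<pi> y u)"
    "\<And>u. \<eta>\<^sub>c y u = 0 \<Longrightarrow> \<psi> (\<psi> u) = - u"
proof -
  let ?b = "\<pi> (pt y)"
  obtain d where d: "d \<in> charts_at B ?b" using charts_at_nonempty[OF smooth_B] by blast
  obtain R where R: "linear R" "\<And>w. \<eta>\<^sub>c y (R w) = 0"
    "\<And>w. d\<pi> y (R w) = tvec_of B d (\<pi> (pt y)) w"
    "\<And>u. \<eta>\<^sub>c y u = 0 \<Longrightarrow> R (d\<pi> y u d) = u"
    using d\<pi>_iso[OF y d] by blast
  have J_in: "J ?b v \<in> tangent_space B ?b" if "v \<in> tangent_space B ?b" for v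
    using J that unfolding almost_complex_structure_def endo_field_def by blast
  have J_sq: "J ?b (J ?b v) = - v" if "v \<in> tangent_space B ?b" for v
    using J that by (simp add: almost_complex_structure_def)
  have J_lin: "linear_on_set (tangent_space B ?b) (J ?b)"
    using J by (simp add: almost_complex_structure_def endo_field_def)
  note d\<pi>_chart = d\<pi>_chart[OF y d]
  define \<psi> where "\<psi> u = R (J ?b (d\<pi> y u) d)" for u
  have "linear (\<lambda>u. d\<pi> y u d)"
    using linear_dird[OF d\<pi>_chart(1)] by (simp add: d\<pi>_chart(2) tvec_of_self[OF smooth_B d])
  \<comment> \<open>\<open>J\<close> is linear on the tangent space only, so its argument is
    rewritten through \<open>tvec_of\<close>.\<close>
  then have "linear (\<lambda>u. J ?b (tvec_of B d ?b (d\<pi> y u d)) d)"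
    using linear_compose[OF _ linear_eval[OF linear_on_set_tvec_of[OF smooth_B d J_lin]]]
    by (simp add: o_def)
  then have 1: "linear \<psi>"
    using linear_compose[OF _ R(1)] tvec_of_coord[OF smooth_B d d\<pi>_in[OF y]] by (simp add: o_def \<psi>_def[abs_def])
  have 2: "d\<pi> y (\<psi> u) = J ?b (d\<pi> y u)" for u
    unfolding \<psi>_def R(3) by (rule tvec_of_coord[OF smooth_B d J_in[OF d\<pi>_in[OF y]]])
  have 3: "\<psi> (\<psi> u) = - u" if u: "\<eta>\<^sub>c y u = 0" for u
  proof -
    have "\<psi> (\<psi> u) = R (- d\<pi> y u d)"
      unfolding \<psi>_def[of "\<psi> u"] 2 J_sq[OF d\<pi>_in[OF y]] by simp
    then show ?thesis using R(4)[OF u] linear_neg[OF R(1)] by simp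
  qed
  show ?thesis by (rule that[of \<psi>]) (use 1 2 3 R(2) in \<open>simp_all add: \<psi>_def\<close>)
qed

end

section \<open>The error tensor\<close>

text \<open>The field \<open>T\<close> is composed with the projection along \<xi> in its
  definition; on the kernel this projection is the identity, so linearity passes to
  \<open>T\<close>.\<close>

lemma ker_endo_field_linear:
  assumes T: "ker_endo_field A \<eta> \<xi> T" and one: "one_form A \<eta>" and A: "smooth_structure A"
    and X: "X \<in> ker_form A \<eta> p" "Y \<in> ker_form A \<eta> p"
  shows "a *\<^sub>R X + b *\<^sub>R Y \<in> ker_form A \<eta> p"
    and "T p (a *\<^sub>R X + b *\<^sub>R Y) = a *\<^sub>R T p X + b *\<^sub>R T p Y"
proof -
  have \<eta>: "linear_on_set (tangent_space A p) (\<eta> p)" using one by (simp add: one_form_def)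
  have t: "X \<in> tangent_space A p" "Y \<in> tangent_space A p" "\<eta> p X = 0" "\<eta> p Y = 0"
    using X by (auto simp: ker_form_def)
  have k: "\<eta> p (a *\<^sub>R X + b *\<^sub>R Y) = 0"
    using linear_on_setD[OF \<eta> t(1,2)] t(3,4) by simp
  show "a *\<^sub>R X + b *\<^sub>R Y \<in> ker_form A \<eta> p"
    using tangent_space_lin[OF A t(1,2)] k by (simp add: ker_form_def)
  have "linear_on_set (tangent_space A p) (\<lambda>v. T p (v - \<eta> p v *\<^sub>R \<xi> p))"
    using T by (simp add: ker_endo_field_def endo_field_def)
  from linear_on_setD[OF this t(1,2), of a b]
  show "T p (a *\<^sub>R X + b *\<^sub>R Y) = a *\<^sub>R T p X + b *\<^sub>R T p Y" by (simp add: k t(3,4))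
qed

text \<open>As h squares to l squared, every vector is the sum of its projections (1/2)(v + h v / l)
  and (1/2)(v - h v / l) onto the eigenspaces of h, which makes \<open>T\<close> an affine function
  of h. For \<alpha> \<noteq> \<beta> this can be solved for h, so eigenvectors of \<open>T\<close>
  are eigenvectors of h.\<close>

lemma two_eigenvalues:
  fixes V :: "'v::real_vector set"
  assumes V: "\<And>a b u v. u \<in> V \<Longrightarrow> v \<in> V \<Longrightarrow> a *\<^sub>R u + b *\<^sub>R v \<in> V"
    and h_in: "\<And>v. v \<in> V \<Longrightarrow> h v \<in> V" and h_lin: "linear_on_set V h" and T_lin: "linear_on_set V T"
    and l: "l > 0" and hh: "\<And>v. v \<in> V \<Longrightarrow> h (h v) = (l * l) *\<^sub>R v"
    and T_plus: "\<And>v. v \<in> V \<Longrightarrow> h v = l *\<^sub>R v \<Longrightarrow> T v = \<alpha> *\<^sub>R v"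
    and T_minus: "\<And>v. v \<in> V \<Longrightarrow> h v = (- l) *\<^sub>R v \<Longrightarrow> T v = \<beta> *\<^sub>R v"
  shows "v \<in> V \<Longrightarrow> T v = ((\<alpha> + \<beta>) / 2) *\<^sub>R v + ((\<alpha> - \<beta>) / (2 * l)) *\<^sub>R h v"
    and "\<alpha> \<noteq> \<beta> \<Longrightarrow> eigenspace_on V T \<alpha> = eigenspace_on V h l"
    and "\<alpha> \<noteq> \<beta> \<Longrightarrow> eigenspace_on V T \<beta> = eigenspace_on V h (- l)"
    and "\<alpha> \<noteq> \<beta> \<Longrightarrow> \<exists>v\<in>V. v \<noteq> 0 \<and> h v = l *\<^sub>R v \<Longrightarrow> \<exists>v\<in>V. v \<noteq> 0 \<and> h v = (- l) *\<^sub>R v \<Longrightarrow>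
      eigenvalues_on V T = {\<alpha>, \<beta>}"
proof -
  have T_eq: "T v = ((\<alpha> + \<beta>) / 2) *\<^sub>R v + ((\<alpha> - \<beta>) / (2 * l)) *\<^sub>R h v" if v: "v \<in> V" for v
  proof -
    define p m where "p = (1/2) *\<^sub>R v + (1 / (2 * l)) *\<^sub>R h v" and "m = (1/2) *\<^sub>R v + (- 1 / (2 * l)) *\<^sub>R h v"
    have pm: "p \<in> V" "m \<in> V" unfolding p_def m_def by (rule V[OF v h_in[OF v]])+
    have "h p = l *\<^sub>R p" "h m = (- l) *\<^sub>R m"
      unfolding p_def m_def linear_on_setD[OF h_lin v h_in[OF v]] hh[OF v]
      using l by (simp_all add: algebra_simps)
    then have T: "T p = \<alpha> *\<^sub>R p" "T m = \<beta> *\<^sub>R m" using T_plus T_minus pm by blast+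
    have "v = 1 *\<^sub>R p + 1 *\<^sub>R m"
      using scaleR_left_distrib[of "1/2" "1/2" v] by (simp add: p_def m_def)
    then have "T v = \<alpha> *\<^sub>R p + \<beta> *\<^sub>R m" using linear_on_setD[OF T_lin pm, of 1 1] T by simp
    also have "\<dots> = (\<alpha> / 2 + \<beta> / 2) *\<^sub>R v + (\<alpha> / (2 * l) - \<beta> / (2 * l)) *\<^sub>R h v"
      unfolding p_def m_def by (simp add: algebra_simps)
    finally show ?thesis by (simp add: add_divide_distrib diff_divide_distrib)
  qed
  then show "v \<in> V \<Longrightarrow> T v = ((\<alpha> + \<beta>) / 2) *\<^sub>R v + ((\<alpha> - \<beta>) / (2 * l)) *\<^sub>R h v" .
  assume ne: "\<alpha> \<noteq> \<beta>"
  have ev: "h v = ((2 * \<gamma> - \<alpha> - \<beta>) * l / (\<alpha> - \<beta>)) *\<^sub>R v" if v: "v \<in> V" "T v = \<gamma> *\<^sub>R v" for v \<gamma>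
  proof -
    have "((\<alpha> - \<beta>) / (2 * l)) *\<^sub>R h v = (\<gamma> - (\<alpha> + \<beta>) / 2) *\<^sub>R v"
      using T_eq[OF v(1)] v(2) by (simp add: scaleR_diff_left)
    then have "(2 * l / (\<alpha> - \<beta>)) *\<^sub>R (((\<alpha> - \<beta>) / (2 * l)) *\<^sub>R h v)
      = (2 * l / (\<alpha> - \<beta>)) *\<^sub>R ((\<gamma> - (\<alpha> + \<beta>) / 2) *\<^sub>R v)" by simp
    moreover have "(2 * l / (\<alpha> - \<beta>)) * ((\<alpha> - \<beta>) / (2 * l)) = 1" using ne l by simp
    moreover have "(2 * l / (\<alpha> - \<beta>)) * (\<gamma> - (\<alpha> + \<beta>) / 2) = (2 * \<gamma> - \<alpha> - \<beta>) * l / (\<alpha> - \<beta>)"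
    proof -
      have "2 * l / d * (r / 2) = r * l / d" for d r :: real by simp
      moreover have "\<gamma> - (\<alpha> + \<beta>) / 2 = (2 * \<gamma> - \<alpha> - \<beta>) / 2" by (simp add: field_simps)
      ultimately show ?thesis by (simp only:)
    qed
    ultimately show ?thesis by (simp only: scaleR_scaleR scaleR_one)
  qed
  have coeff: "(2 * \<alpha> - \<alpha> - \<beta>) * l / (\<alpha> - \<beta>) = l" "(2 * \<beta> - \<alpha> - \<beta>) * l / (\<alpha> - \<beta>) = - l"
    using ne by (simp_all add: field_simps)
  have "h v = l *\<^sub>R v" if "v \<in> V" "T v = \<alpha> *\<^sub>R v" for v
    using ev[OF that] unfolding coeff .
  moreover have "h v = (- l) *\<^sub>R v" if "v \<in> V" "T v = \<beta> *\<^sub>R v" for v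
    using ev[OF that] unfolding coeff .
  ultimately show "eigenspace_on V T \<alpha> = eigenspace_on V h l" "eigenspace_on V T \<beta> = eigenspace_on V h (- l)"
    using T_plus T_minus unfolding eigenspace_on_def by blast+
  assume ex: "\<exists>v\<in>V. v \<noteq> 0 \<and> h v = l *\<^sub>R v" "\<exists>v\<in>V. v \<noteq> 0 \<and> h v = (- l) *\<^sub>R v"
  have "\<gamma> = \<alpha> \<or> \<gamma> = \<beta>" if v: "v \<in> V" "v \<noteq> 0" "T v = \<gamma> *\<^sub>R v" for v \<gamma>
  proof -
    \<comment> \<open>The eigenvalue of h belonging to the eigenvalue \<gamma> of \<open>T\<close>.
      It must square to l squared, so only l and - l occur.\<close>
    define r where "r = (2 * \<gamma> - \<alpha> - \<beta>) * l / (\<alpha> - \<beta>)"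
    have hv: "h v = r *\<^sub>R v" unfolding r_def by (rule ev[OF v(1,3)])
    then have "h (h v) = r *\<^sub>R h v" using linear_on_setD[OF h_lin v(1,1), of r 0] by simp
    then have "(r * r) *\<^sub>R v = (l * l) *\<^sub>R v" using hh[OF v(1)] hv by simp
    then have "r = l \<or> r = - l" using v(2) by (simp add: square_eq_iff)
    then show ?thesis
    proof
      assume "r = l"
      then have "T v = \<alpha> *\<^sub>R v" using T_plus v(1) hv by simp
      then show ?thesis using v by simp
    next
      assume "r = - l"
      then have "T v = \<beta> *\<^sub>R v" using T_minus v(1) hv by simp
      then show ?thesis using v by simp
    qed
  qed
  then show "eigenvalues_on V T = {\<alpha>, \<beta>}"
    using ex T_plus T_minus unfolding eigenvalues_on_def by blast
qed

section \<open>The error tensor at a point of an adapted chart\<close>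

context regular_chart
begin

text \<open>A Euclidean space has positive dimension, so the base has a nonzero tangent vector, and
  its horizontal lift is nonzero.\<close>

lemma ker_nontrivial:
  assumes y: "y \<in> S" shows "\<exists>u. u \<noteq> 0 \<and> \<eta>\<^sub>c y u = 0"
proof -
  obtain d where d: "d \<in> charts_at B (\<pi> (pt y))" using charts_at_nonempty[OF smooth_B] by blast
  obtain R where R: "linear R" "\<And>w. \<eta>\<^sub>c y (R w) = 0" "\<And>w. d\<pi> y (R w) = tvec_of B d (\<pi> (pt y)) w"
    "\<And>u. \<eta>\<^sub>c y u = 0 \<Longrightarrow> R (d\<pi> y u d) = u"
    using d\<pi>_iso[OF y d] by blast
  obtain w :: 'f where w: "w \<noteq> 0" using nonempty_Basis nonzero_Basis by blast
  have "d\<pi> y 0 = 0" using d\<pi>_lin[OF y, of 0 0 0 0] by simp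
  then have "R w \<noteq> 0" using R(3)[of w] w tvec_of_self[OF smooth_B d, of w] by (metis zero_fun_apply)
  then show ?thesis using R(2) by blast
qed

lemma tangent_map_surj:
  assumes y: "y \<in> S" and w: "w \<in> tangent_space B (\<pi> (pt y))"
  shows "\<exists>X\<in>ker_form A \<eta> (pt y). tangent_map A B \<pi> (pt y) X = w"
proof -
  obtain d where d: "d \<in> charts_at B (\<pi> (pt y))" using charts_at_nonempty[OF smooth_B] by blast
  obtain R where R: "linear R" "\<And>w. \<eta>\<^sub>c y (R w) = 0" "\<And>w. d\<pi> y (R w) = tvec_of B d (\<pi> (pt y)) w"
    "\<And>u. \<eta>\<^sub>c y u = 0 \<Longrightarrow> R (d\<pi> y u d) = u"
    using d\<pi>_iso[OF y d] by blast
  have "tangent_map A B \<pi> (pt y) (tv y (R (w d))) = w"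
    using R(3)[of "w d"] tvec_of_coord[OF smooth_B d w] by (simp add: d\<pi>_def)
  then show ?thesis using R(2) ker_iff[OF y] by blast
qed

text \<open>Supplies \<open>error_on_eigenspaces\<close> with its data at \<open>x\<close> and
  translates the outcome back to tangent vectors. The anticommutation of \<psi> with h is needed
  along the Reeb line, not only at \<open>x\<close>, since it is differentiated.\<close>

lemma error_tensor_in_chart:
  fixes T f g
  defines "l \<equiv> sqrt (1 - \<kappa>)" and "a \<equiv> 2 - \<mu>"
  assumes x: "x \<in> S" and \<kappa>: "\<kappa> < 1"
    and sol: "error_solution A B \<eta> \<xi> g\<^sub>M \<pi> \<omega> T f g" and comm: "commute_on_ker A \<eta> h T"
  shows "\<bar>a\<bar> > 2 * l"
    and "X \<in> ker_form A \<eta> (pt x) \<Longrightarrow> h (pt x) X \<in> ker_form A \<eta> (pt x)"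
    and "X \<in> ker_form A \<eta> (pt x) \<Longrightarrow> h (pt x) (h (pt x) X) = (l * l) *\<^sub>R X"
    and "X \<in> ker_form A \<eta> (pt x) \<Longrightarrow> h (pt x) X = l *\<^sub>R X \<Longrightarrow>
      T (pt x) X = (1 - exp (2 * f (pt x)) * sqrt ((a + 2 * l) / (a - 2 * l))) *\<^sub>R X"
    and "X \<in> ker_form A \<eta> (pt x) \<Longrightarrow> h (pt x) X = (- l) *\<^sub>R X \<Longrightarrow>
      T (pt x) X = (1 - exp (2 * f (pt x)) * sqrt ((a - 2 * l) / (a + 2 * l))) *\<^sub>R X"
    and "\<exists>X\<in>ker_form A \<eta> (pt x). X \<noteq> 0 \<and> h (pt x) X = l *\<^sub>R X"
    and "\<exists>X\<in>ker_form A \<eta> (pt x). X \<noteq> 0 \<and> h (pt x) X = (- l) *\<^sub>R X"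
proof -
  let ?G = "rep2 A c g\<^sub>M" and ?h = "rep_endo A c h" and ?\<phi> = "rep_endo A c \<phi>"
  define b where "b = \<pi> (pt x)"
  have l: "l > 0" "l * l = 1 - \<kappa>" using \<kappa> by (simp_all add: l_def)
  have T: "ker_endo_field A \<eta> \<xi> T" and g: "associated_metric B \<omega> g"
    and eq: "\<And>p X Y. X \<in> ker_form A \<eta> p \<Longrightarrow> Y \<in> ker_form A \<eta> p \<Longrightarrow> g\<^sub>M p (T p X) Y =
      g\<^sub>M p X Y - exp (2 * f p) * g (\<pi> p) (tangent_map A B \<pi> p X) (tangent_map A B \<pi> p Y)"
    using sol by (auto simp: error_solution_def)
  obtain J where J: "almost_complex_structure B J"
    and gJ: "\<And>p u v. u \<in> tangent_space B p \<Longrightarrow> v \<in> tangent_space B p \<Longrightarrow> g p u (J p v) = \<omega> p u v"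
    using g by (auto simp: associated_metric_def)
  have g_sym: "g p u v = g p v u" if "u \<in> tangent_space B p" "v \<in> tangent_space B p" for p u v
    using g that by (auto simp: associated_metric_def riemannian_metric_def)
  have g_pos: "g p u u > 0" if "u \<in> tangent_space B p" "u \<noteq> 0" for p u
    using g that by (auto simp: associated_metric_def riemannian_metric_def)
  \<comment> \<open>The error equation is solved for the lifted metric: with this factor, G(s u, v)
    = g(d\<pi> u, d\<pi> v) and \<open>f\<close> disappears.\<close>
  define s where "s y u = exp (- 2 * f (pt y)) *\<^sub>R (u - T (pt y) (tv y u) c)" for y u
  define Q where "Q u v = g b (d\<pi> x u) (d\<pi> x v)" for u v
  have T_in: "T (pt y) (tv y u) \<in> ker_form A \<eta> (pt y)" if "y \<in> S" "\<eta>\<^sub>c y u = 0" for y u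
    using T that ker_iff[OF that(1)] unfolding ker_endo_field_def by blast
  have tvT: "tv y (T (pt y) (tv y u) c) = T (pt y) (tv y u)" if "y \<in> S" "\<eta>\<^sub>c y u = 0" for y u
    using tv_coord[OF that(1)] T_in[OF that] by (simp add: ker_form_def)
  have T_ker: "\<eta>\<^sub>c y (T (pt y) (tv y u) c) = 0" if "y \<in> S" "\<eta>\<^sub>c y u = 0" for y u
    using ker_iff[OF that(1)] tvT[OF that] T_in[OF that] by simp
  have s_ker: "\<eta>\<^sub>c y (s y u) = 0" if "y \<in> S" "\<eta>\<^sub>c y u = 0" for y u
    using that T_ker[OF that] by (simp add: s_def \<eta>_simps)
  have s_G: "?G y (s y u) v = g (\<pi> (pt y)) (d\<pi> y u) (d\<pi> y v)"
    if y: "y \<in> S" and u: "\<eta>\<^sub>c y u = 0" and v: "\<eta>\<^sub>c y v = 0" for y u v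
  proof -
    have "?G y (T (pt y) (tv y u) c) v = g\<^sub>M (pt y) (T (pt y) (tv y u)) (tv y v)"
      by (simp add: rep2_def tvT[OF y u])
    also have "\<dots> = ?G y u v - exp (2 * f (pt y)) * g (\<pi> (pt y)) (d\<pi> y u) (d\<pi> y v)"
      using u v ker_iff[OF y] by (simp add: eq rep2_def d\<pi>_def)
    finally show ?thesis using y by (simp add: s_def G_simps exp_minus)
  qed
  have sh: "s y (?h y u) = ?h y (s y u)" if y: "y \<in> S" and u: "\<eta>\<^sub>c y u = 0" for y u
  proof -
    have "?h y (T (pt y) (tv y u) c) = h (pt y) (T (pt y) (tv y u)) c"
      by (simp add: rep_endo_def tvT[OF y u])
    also have "\<dots> = T (pt y) (tv y (?h y u)) c"
      using comm u ker_iff[OF y] by (simp add: commute_on_ker_def tv_endo[OF y])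
    finally show ?thesis using y by (simp add: s_def h_simps)
  qed
  obtain \<psi> where \<psi>: "linear \<psi>" "\<And>u. \<eta>\<^sub>c x (\<psi> u) = 0"
    "\<And>u. \<eta>\<^sub>c x u = 0 \<Longrightarrow> d\<pi> x (\<psi> u) = J b (d\<pi> x u)"
    "\<And>u. \<eta>\<^sub>c x u = 0 \<Longrightarrow> \<psi> (\<psi> u) = - u"
    using lifted_complex_structure[OF x J] unfolding b_def by blast
  have d\<pi>_in_b: "d\<pi> x u \<in> tangent_space B b" for u
    unfolding b_def by (rule d\<pi>_in[OF x])
  have Q_sym: "Q u v = Q v u" for u v
    unfolding Q_def by (rule g_sym[OF d\<pi>_in_b d\<pi>_in_b])
  have Q_\<psi>: "Q u (\<psi> v) = \<omega> b (d\<pi> x u) (d\<pi> x v)" if "\<eta>\<^sub>c x v = 0" for u v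
    unfolding Q_def \<psi>(3)[OF that] by (rule gJ[OF d\<pi>_in_b d\<pi>_in_b])
  have Q_\<psi>_x: "Q u (\<psi> v) = ?G x u (?\<phi> x v)" if "\<eta>\<^sub>c x v = 0" for u v
    unfolding Q_\<psi>[OF that] \<Omega>_pullback[OF x] b_def ..
  have Q_pos: "Q u u > 0" if "\<eta>\<^sub>c x u = 0" "u \<noteq> 0" for u
    unfolding Q_def using d\<pi>_kernel[OF x that(1)] that(2) by (intro g_pos d\<pi>_in_b) blast
  obtain \<epsilon> where \<epsilon>: "\<epsilon> > 0" "\<And>t. \<bar>t\<bar> < \<epsilon> \<Longrightarrow> x + t *\<^sub>R e\<^sub>0 \<in> S"
    using line_in_ran[OF x] by blast
  \<comment> \<open>\<psi> and \<open>Q\<close> are built at \<open>x\<close> but serve at every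
    nearby point of the line, because \<eta>, d\<pi> and the base point are constant there. The
    metric, \<phi>, h and \<open>s\<close> may vary.\<close>
  have anti: "\<psi> (?h (x + t *\<^sub>R e\<^sub>0) u) = - ?h (x + t *\<^sub>R e\<^sub>0) (\<psi> u)"
    if t: "\<bar>t\<bar> < \<epsilon>" and u: "\<eta>\<^sub>c x u = 0" for t u
  proof -
    let ?y = "x + t *\<^sub>R e\<^sub>0"
    note y = \<epsilon>(2)[OF t]
    have \<eta>y: "\<eta>\<^sub>c ?y v = \<eta>\<^sub>c x v" and d\<pi>y: "d\<pi> ?y v = d\<pi> x v" and \<pi>y: "\<pi> (pt ?y) = b" for v
      by (simp_all add: \<eta>\<^sub>c_const[OF x y] d\<pi>_const[OF x y] \<pi>_const[OF x y] b_def)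
    show ?thesis
    proof (rule lifted_structure_anticommute(3)[where y = ?y and s = "s ?y" and Q = Q])
      show "?G ?y (s ?y u) v = Q u v" if "\<eta>\<^sub>c ?y u = 0" "\<eta>\<^sub>c ?y v = 0" for u v
        using s_G[OF y that] by (simp add: Q_def d\<pi>y \<pi>y)
      show "Q u (\<psi> v) = ?G ?y u (?\<phi> ?y v)" if "\<eta>\<^sub>c ?y v = 0" for u v
        using Q_\<psi>[of v u] that by (simp add: \<Omega>_pullback[OF y] \<eta>y d\<pi>y \<pi>y)
      show "\<psi> (\<psi> u) = - u" if "\<eta>\<^sub>c ?y u = 0" for u using \<psi>(4) that by (simp add: \<eta>y)
      show "\<eta>\<^sub>c ?y (\<psi> u) = 0" for u using \<psi>(2) by (simp add: \<eta>y)
      show "\<eta>\<^sub>c ?y u = 0" using u by (simp add: \<eta>y)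
      show "Q u v = Q v u" for u v by (rule Q_sym)
    qed (fact y s_ker[OF y] sh[OF y])+
  qed
  define k where "k u = dird (\<lambda>y. ?h y u) x e\<^sub>0" for u
  have k_\<psi>: "\<psi> (k u) = - k (\<psi> u)" if "\<eta>\<^sub>c x u = 0" for u
    unfolding k_def by (rule dird_h_anticommute[OF x \<epsilon>(1) \<psi>(1) anti[OF _ that]])
  \<comment> \<open>The curvature condition for the pair (u, \<xi>).\<close>
  have R: "curvature ?G (\<lambda>_. u) (\<lambda>_. e\<^sub>0) (rep_vf c \<xi>) x =
      \<kappa> *\<^sub>R (\<eta>\<^sub>c x e\<^sub>0 *\<^sub>R u - \<eta>\<^sub>c x u *\<^sub>R e\<^sub>0) +
      \<mu> *\<^sub>R (\<eta>\<^sub>c x e\<^sub>0 *\<^sub>R ?h x u - \<eta>\<^sub>c x u *\<^sub>R ?h x e\<^sub>0)" for u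
    using M c x by (simp add: kappa_mu_manifold_def)
  have hh: "?h x (?h x u) = (l * l) *\<^sub>R u" if "\<eta>\<^sub>c x u = 0" for u
    unfolding l by (rule kappa_mu_structure(1)[OF x rep_\<xi> R that])
  have k: "k u = (2 * (l * l)) *\<^sub>R ?\<phi> x u - a *\<^sub>R ?h x (?\<phi> x u)" if "\<eta>\<^sub>c x u = 0" for u
    unfolding l a_def k_def by (rule kappa_mu_structure(2)[OF x rep_\<xi> R that])
  have s_Gx: "?G x (s x u) v = Q u v" if "\<eta>\<^sub>c x u = 0" "\<eta>\<^sub>c x v = 0" for u v
    unfolding Q_def b_def by (rule s_G[OF x that])
  have K: "Q u v = Q v u" "\<eta>\<^sub>c x (\<psi> u) = 0" "Q u (\<psi> v) = ?G x u (?\<phi> x v)"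
    if "\<eta>\<^sub>c x u = 0" "\<eta>\<^sub>c x v = 0" for u v
    by (rule Q_sym \<psi>(2) Q_\<psi>_x[OF that(2)])+
  note E = x l(1) hh k k_\<psi> s_ker[OF x] s_Gx K(1,3) Q_pos K(2)[OF _ linear_0[OF \<eta>_lin[OF x]]] \<psi>(4) sh[OF x] ker_nontrivial[OF x]
  show "\<bar>a\<bar> > 2 * l"
    by (rule error_on_eigenspaces(1)[where s = "s x" and Q = Q and \<psi> = \<psi> and k = k]) (fact E)+
  have coord: "X c \<noteq> 0 \<longleftrightarrow> X \<noteq> 0" "\<eta>\<^sub>c x (X c) = 0" "tv x (X c) = X"
    if "X \<in> ker_form A \<eta> (pt x)" for X
  proof -
    show *: "tv x (X c) = X" using tv_coord[OF x] that by (simp add: ker_form_def)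
    show "\<eta>\<^sub>c x (X c) = 0" using ker_iff[OF x, of "X c"] that by (simp add: *)
    have "tv x 0 = 0" using tvec_of_lin[OF smooth_A c_at[OF x], of 0 0 0 0] by simp
    then show "X c \<noteq> 0 \<longleftrightarrow> X \<noteq> 0" using * by auto
  qed
  have h_coord: "?h x (X c) = h (pt x) X c" if "X \<in> ker_form A \<eta> (pt x)" for X
    by (simp add: rep_endo_def coord(3)[OF that])
  show h_in: "h (pt x) X \<in> ker_form A \<eta> (pt x)" if X: "X \<in> ker_form A \<eta> (pt x)" for X
    using ker_iff[OF x, of "?h x (X c)"] \<eta>_h[OF x] tv_endo(2)[OF x, of "X c"] by (simp add: coord(3)[OF X])
  show "h (pt x) (h (pt x) X) = (l * l) *\<^sub>R X" if X: "X \<in> ker_form A \<eta> (pt x)" for X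
  proof (rule tvec_eqI[OF smooth_A c_at[OF x]])
    show "h (pt x) (h (pt x) X) \<in> tangent_space A (pt x)" using h_in[OF h_in[OF X]] by (simp add: ker_form_def)
    have X': "X \<in> tangent_space A (pt x)" using X by (simp add: ker_form_def)
    show "(l * l) *\<^sub>R X \<in> tangent_space A (pt x)"
      using tangent_space_lin[OF smooth_A X' X', of "l * l" 0] by simp
    show "h (pt x) (h (pt x) X) c = ((l * l) *\<^sub>R X) c"
      using hh[OF coord(2)[OF X]] by (simp add: h_coord[OF X] h_coord[OF h_in[OF X], symmetric] scaleR_fun_def)
  qed
  \<comment> \<open>Inverts the definition of \<open>s\<close> on an eigenvector.\<close>
  have T_from_s: "T (pt x) X = (1 - exp (2 * f (pt x)) * \<sigma>) *\<^sub>R X"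
    if X: "X \<in> ker_form A \<eta> (pt x)" and \<sigma>: "s x (X c) = \<sigma> *\<^sub>R X c" for X \<sigma>
  proof (rule tvec_eqI[OF smooth_A c_at[OF x]])
    show "T (pt x) X \<in> tangent_space A (pt x)"
      using T_in[OF x coord(2)[OF X]] by (simp add: coord(3)[OF X] ker_form_def)
    have X': "X \<in> tangent_space A (pt x)" using X by (simp add: ker_form_def)
    show "(1 - exp (2 * f (pt x)) * \<sigma>) *\<^sub>R X \<in> tangent_space A (pt x)"
      using tangent_space_lin[OF smooth_A X' X', of "1 - exp (2 * f (pt x)) * \<sigma>" 0] by simp
    have "exp (2 * f (pt x)) *\<^sub>R s x (X c) = X c - T (pt x) X c"
      by (simp add: s_def coord(3)[OF X] exp_minus)
    then have "X c - T (pt x) X c = (exp (2 * f (pt x)) * \<sigma>) *\<^sub>R X c" by (simp add: \<sigma>)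
    then show "T (pt x) X c = ((1 - exp (2 * f (pt x)) * \<sigma>) *\<^sub>R X) c"
      by (simp add: scaleR_fun_def scaleR_diff_left algebra_simps)
  qed
  show "T (pt x) X = (1 - exp (2 * f (pt x)) * sqrt ((a + 2 * l) / (a - 2 * l))) *\<^sub>R X"
    if X: "X \<in> ker_form A \<eta> (pt x)" "h (pt x) X = l *\<^sub>R X" for X
  proof (rule T_from_s[OF X(1)])
    have *: "\<eta>\<^sub>c x (X c) = 0" "?h x (X c) = l *\<^sub>R X c"
      using X by (simp_all add: coord h_coord scaleR_fun_def)
    show "s x (X c) = sqrt ((a + 2 * l) / (a - 2 * l)) *\<^sub>R X c"
      by (rule error_on_eigenspaces(2)[where s = "s x" and Q = Q and \<psi> = \<psi> and k = k]) (fact E *)+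
  qed
  show "T (pt x) X = (1 - exp (2 * f (pt x)) * sqrt ((a - 2 * l) / (a + 2 * l))) *\<^sub>R X"
    if X: "X \<in> ker_form A \<eta> (pt x)" "h (pt x) X = (- l) *\<^sub>R X" for X
  proof (rule T_from_s[OF X(1)])
    have *: "\<eta>\<^sub>c x (X c) = 0" "?h x (X c) = (- l) *\<^sub>R X c"
      using X by (simp_all add: coord h_coord scaleR_fun_def)
    show "s x (X c) = sqrt ((a - 2 * l) / (a + 2 * l)) *\<^sub>R X c"
      by (rule error_on_eigenspaces(3)[where s = "s x" and Q = Q and \<psi> = \<psi> and k = k]) (fact E *)+
  qed
  have eigen: "\<exists>X\<in>ker_form A \<eta> (pt x). X \<noteq> 0 \<and> h (pt x) X = r *\<^sub>R X"
    if ex: "\<exists>u. u \<noteq> 0 \<and> \<eta>\<^sub>c x u = 0 \<and> ?h x u = r *\<^sub>R u" for r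
  proof -
    obtain u where u: "u \<noteq> 0" "\<eta>\<^sub>c x u = 0" "?h x u = r *\<^sub>R u" using ex by blast
    have X: "tv x u \<in> ker_form A \<eta> (pt x)" using u(2) ker_iff[OF x] by simp
    have "h (pt x) (tv x u) = r *\<^sub>R tv x u"
      using tv_endo(2)[OF x, of u, unfolded u(3)] tvec_of_lin[OF smooth_A c_at[OF x], of r u 0 u]
      by (simp only: scaleR_zero_left add_0_right)
    moreover have "tv x u \<noteq> 0" using coord(1)[OF X] u(1) x by simp
    ultimately show ?thesis using X by blast
  qed
  show "\<exists>X\<in>ker_form A \<eta> (pt x). X \<noteq> 0 \<and> h (pt x) X = l *\<^sub>R X"
    by (rule eigen, rule error_on_eigenspaces(4)[where s = "s x" and Q = Q and \<psi> = \<psi> and k = k]) (fact E)+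
  show "\<exists>X\<in>ker_form A \<eta> (pt x). X \<noteq> 0 \<and> h (pt x) X = (- l) *\<^sub>R X"
    by (rule eigen, rule error_on_eigenspaces(5)[where s = "s x" and Q = Q and \<psi> = \<psi> and k = k]) (fact E)+
qed

end

section \<open>From adapted charts to the whole manifold\<close>

lemma regular_chart_at:
  assumes M: "kappa_mu_manifold A n \<eta> \<xi> g\<^sub>M \<phi> h \<kappa> \<mu>" and flow: "is_flow A \<xi> \<theta>"
    and regular: "regular_field A \<xi> \<theta>" and fibration: "boothby_wang A B n \<eta> \<theta> \<pi> \<omega>"
  obtains c e\<^sub>0 where "regular_chart A B n \<eta> \<xi> g\<^sub>M \<phi> h \<kappa> \<mu> \<theta> \<pi> \<omega> c e\<^sub>0" "p \<in> chart_dom c"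
proof -
  from spec[OF regular[unfolded regular_field_def], of p]
  obtain c a i where c: "c \<in> charts_at A p" "chart_ran c = box (- (a *\<^sub>R One)) (a *\<^sub>R One)"
    "\<forall>q\<in>chart_dom c. \<xi> q c = i"
    by (elim bexE exE conjE) (rule that)
  have "regular_chart A B n \<eta> \<xi> g\<^sub>M \<phi> h \<kappa> \<mu> \<theta> \<pi> \<omega> c i"
    using M flow fibration c by unfold_locales (simp_all add: charts_at_def)
  then show ?thesis using that c(1) by (auto simp: charts_at_def)
qed

text \<open>\<sigma> and \<tau> depend on \<kappa> and \<mu> alone, and the conformal factor enters
  only through \<alpha> and \<beta>. In the last clause it has cancelled, so the right-hand side
  involves neither \<open>T\<close> nor \<open>f\<close>.\<close>

lemma error_tensor:
  fixes A :: "('m::{t2_space, second_countable_topology}, 'e::euclidean_space) chart set"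
    and B :: "('b::{t2_space, second_countable_topology}, 'f::euclidean_space) chart set"
    and T f g p and \<kappa> \<mu> :: real
  defines "l \<equiv> sqrt (1 - \<kappa>)" and "a \<equiv> 2 - \<mu>"
  defines "\<sigma> \<equiv> sqrt ((a + 2 * l) / (a - 2 * l))" and "\<tau> \<equiv> sqrt ((a - 2 * l) / (a + 2 * l))"
  defines "\<alpha> \<equiv> 1 - exp (2 * f p) * \<sigma>" and "\<beta> \<equiv> 1 - exp (2 * f p) * \<tau>"
  assumes M: "kappa_mu_manifold A n \<eta> \<xi> g\<^sub>M \<phi> h \<kappa> \<mu>" and \<kappa>: "\<kappa> < 1"
    and flow: "is_flow A \<xi> \<theta>" and regular: "regular_field A \<xi> \<theta>"
    and fibration: "boothby_wang A B n \<eta> \<theta> \<pi> \<omega>"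
    and sol: "error_solution A B \<eta> \<xi> g\<^sub>M \<pi> \<omega> T f g" and comm: "commute_on_ker A \<eta> h T"
  shows "\<bar>a\<bar> > 2 * l" and "\<alpha> \<noteq> \<beta>"
    and "eigenvalues_on (ker_form A \<eta> p) (T p) = {\<alpha>, \<beta>}"
    and "eigenspace_on (ker_form A \<eta> p) (T p) \<alpha> = eigenspace_on (ker_form A \<eta> p) (h p) l"
    and "eigenspace_on (ker_form A \<eta> p) (T p) \<beta> = eigenspace_on (ker_form A \<eta> p) (h p) (- l)"
    and "X \<in> ker_form A \<eta> p \<Longrightarrow> T p X = ((\<alpha> + \<beta>) / 2) *\<^sub>R X + ((\<alpha> - \<beta>) / (2 * l)) *\<^sub>R h p X"
    and "X \<in> ker_form A \<eta> p \<Longrightarrow> Y \<in> ker_form A \<eta> p \<Longrightarrow>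
      g (\<pi> p) (tangent_map A B \<pi> p X) (tangent_map A B \<pi> p Y)
      = (\<sigma> + \<tau>) / 2 * g\<^sub>M p X Y + (\<sigma> - \<tau>) / (2 * l) * g\<^sub>M p (h p X) Y"
proof -
  let ?V = "ker_form A \<eta> p"
  obtain c e\<^sub>0 where "regular_chart A B n \<eta> \<xi> g\<^sub>M \<phi> h \<kappa> \<mu> \<theta> \<pi> \<omega> c e\<^sub>0" and pc: "p \<in> chart_dom c"
    using regular_chart_at[OF M flow regular fibration] by blast
  then interpret regular_chart A B n \<eta> \<xi> g\<^sub>M \<phi> h \<kappa> \<mu> \<theta> \<pi> \<omega> c e\<^sub>0 by blast
  have p: "pt (chart_map c p) = p" "chart_map c p \<in> S"
    using chart_inv_map[OF chart pc] chart_map_in[OF pc] by auto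
  note E = error_tensor_in_chart[OF p(2) \<kappa> sol comm, unfolded p(1), folded l_def a_def,
      folded \<sigma>_def \<tau>_def, folded \<alpha>_def \<beta>_def]
  have l: "l > 0" using \<kappa> by (simp add: l_def)
  show al: "\<bar>a\<bar> > 2 * l" by (rule E(1))
  \<comment> \<open>Equality would force (a + 2l) and (a - 2l) to have equal squares, that is a l =
    0.\<close>
  have ne: "\<sigma> \<noteq> \<tau>"
  proof
    assume "\<sigma> = \<tau>"
    then have "(a + 2 * l) / (a - 2 * l) = (a - 2 * l) / (a + 2 * l)" by (simp add: \<sigma>_def \<tau>_def)
    moreover have "a + 2 * l \<noteq> 0" "a - 2 * l \<noteq> 0" using al l by auto
    ultimately have "(a + 2 * l) * (a + 2 * l) = (a - 2 * l) * (a - 2 * l)"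
      by (simp add: frac_eq_eq)
    then have "a * l = 0" by (simp add: algebra_simps)
    then show False using al l by auto
  qed
  then show ne': "\<alpha> \<noteq> \<beta>" by (simp add: \<alpha>_def \<beta>_def)
  have T: "ker_endo_field A \<eta> \<xi> T" using sol by (simp add: error_solution_def)
  note lin = ker_endo_field_linear[OF T one_form smooth_A]
  have T_lin: "linear_on_set ?V (T p)" unfolding linear_on_set_def using lin(2) by blast
  have h_lin: "linear_on_set ?V (h p)"
    using endo(2) unfolding endo_field_def linear_on_set_def ker_form_def by blast
  note two = two_eigenvalues[where V = ?V and h = "h p" and T = "T p" and l = l and \<alpha> = \<alpha> and \<beta> = \<beta>]
  note F = lin(1) E(2) h_lin T_lin l E(3,4,5) ne' E(6,7)
  show "eigenvalues_on ?V (T p) = {\<alpha>, \<beta>}" by (rule two(4)) (fact F)+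
  show "eigenspace_on ?V (T p) \<alpha> = eigenspace_on ?V (h p) l" by (rule two(2)) (fact F)+
  show "eigenspace_on ?V (T p) \<beta> = eigenspace_on ?V (h p) (- l)" by (rule two(3)) (fact F)+
  show T_eq: "T p X = ((\<alpha> + \<beta>) / 2) *\<^sub>R X + ((\<alpha> - \<beta>) / (2 * l)) *\<^sub>R h p X" if "X \<in> ?V" for X
    by (rule two(1)) (fact F that)+
  show "g (\<pi> p) (tangent_map A B \<pi> p X) (tangent_map A B \<pi> p Y)
      = (\<sigma> + \<tau>) / 2 * g\<^sub>M p X Y + (\<sigma> - \<tau>) / (2 * l) * g\<^sub>M p (h p X) Y"
    if X: "X \<in> ?V" and Y: "Y \<in> ?V" for X Y
  proof -
    let ?g = "g (\<pi> p) (tangent_map A B \<pi> p X) (tangent_map A B \<pi> p Y)"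
    have t: "X \<in> tangent_space A p" "h p X \<in> tangent_space A p" "Y \<in> tangent_space A p"
      using X Y E(2)[OF X] by (auto simp: ker_form_def)
    have "linear_on_set (tangent_space A p) (\<lambda>v. g\<^sub>M p v Y)"
      using metric t(3) by (simp add: riemannian_metric_def bilinear_field_def)
    from linear_on_setD[OF this t(1,2)]
    have "g\<^sub>M p (T p X) Y = (\<alpha> + \<beta>) / 2 * g\<^sub>M p X Y + (\<alpha> - \<beta>) / (2 * l) * g\<^sub>M p (h p X) Y"
      unfolding T_eq[OF X] by simp
    moreover have "g\<^sub>M p (T p X) Y = g\<^sub>M p X Y - exp (2 * f p) * ?g"
      using sol X Y by (simp add: error_solution_def)
    moreover have "(\<alpha> + \<beta>) / 2 = 1 - exp (2 * f p) * ((\<sigma> + \<tau>) / 2)"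
      "(\<alpha> - \<beta>) / (2 * l) = - exp (2 * f p) * ((\<sigma> - \<tau>) / (2 * l))"
      by (simp_all add: \<alpha>_def \<beta>_def field_simps)
    \<comment> \<open>Pure algebra comparing the two expressions for
      \<open>g\<^sub>M p (T p X) Y\<close>; the positive factor \<open>exp (2 * f p)\<close> is
      cancelled afterwards.\<close>
    moreover have "E * G = E * (r * u + r' * v)"
      if "m = d * u + d' * v" "m = u - E * G" "d = 1 - E * r" "d' = - E * r'" for m d d' u v E G r r' :: real
      using that by (simp add: algebra_simps)
    ultimately have "exp (2 * f p) * ?g =
      exp (2 * f p) * ((\<sigma> + \<tau>) / 2 * g\<^sub>M p X Y + (\<sigma> - \<tau>) / (2 * l) * g\<^sub>M p (h p X) Y)"
      by blast
    then show ?thesis by simp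
  qed
qed

theorem theorem1p2:
  fixes A :: "('m::{t2_space, second_countable_topology}, 'e::euclidean_space) chart set"
    and B :: "('b::{t2_space, second_countable_topology}, 'f::euclidean_space) chart set"
    and n :: nat
    and \<eta> :: "('m, 'e) form1" and \<xi> :: "('m, 'e) vfield" and g\<^sub>M :: "('m, 'e) form2"
    and \<phi> h T :: "('m, 'e) endo" and \<kappa> \<mu> :: real
    and \<theta> :: "real \<Rightarrow> 'm \<Rightarrow> 'm" and \<pi> :: "'m \<Rightarrow> 'b" and \<omega> g :: "('b, 'f) form2"
    and f :: "'m \<Rightarrow> real"
  assumes M: "kappa_mu_manifold A n \<eta> \<xi> g\<^sub>M \<phi> h \<kappa> \<mu>"
    and non_sasakian: "non_sasakian \<kappa>"
    and closed: "compact (UNIV :: 'm set)"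
    and flow: "is_flow A \<xi> \<theta>"
    and regular: "regular_field A \<xi> \<theta>"
    and fibration: "boothby_wang A B n \<eta> \<theta> \<pi> \<omega>"
    and solution: "error_solution A B \<eta> \<xi> g\<^sub>M \<pi> \<omega> T f g"
    and commute: "commute_on_ker A \<eta> h T"
  shows
    "\<bar>boeckx_index \<kappa> \<mu>\<bar> > 1 \<and>
     (\<forall>p. \<exists>a b. a \<noteq> b \<and> eigenvalues_on (ker_form A \<eta> p) (T p) = {a, b} \<and>
        eigenspace_on (ker_form A \<eta> p) (T p) a =
          eigenspace_on (ker_form A \<eta> p) (h p) (sqrt (1 - \<kappa>)) \<and>
        eigenspace_on (ker_form A \<eta> p) (T p) b =
          eigenspace_on (ker_form A \<eta> p) (h p) (- sqrt (1 - \<kappa>))) \<and>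
     (\<forall>T' f' g'. error_solution A B \<eta> \<xi> g\<^sub>M \<pi> \<omega> T' f' g' \<and> commute_on_ker A \<eta> h T' \<longrightarrow>
        (\<forall>p. f' p = f p \<longrightarrow>
             eigenvalues_on (ker_form A \<eta> p) (T' p) = eigenvalues_on (ker_form A \<eta> p) (T p) \<and>
             (\<forall>X\<in>ker_form A \<eta> p. T' p X = T p X))) \<and>
     (\<forall>T' f' g'. error_solution A B \<eta> \<xi> g\<^sub>M \<pi> \<omega> T' f' g' \<and> commute_on_ker A \<eta> h T' \<longrightarrow>
        (\<forall>b. \<forall>u\<in>tangent_space B b. \<forall>v\<in>tangent_space B b. g b u v = g' b u v))"
proof (intro conjI allI impI)
  have \<kappa>: "\<kappa> < 1" using non_sasakian by (simp add: non_sasakian_def)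
  note E = error_tensor[OF M \<kappa> flow regular fibration]
  note E0 = E[OF solution commute]
  show "\<bar>boeckx_index \<kappa> \<mu>\<bar> > 1"
  proof -
    have l: "sqrt (1 - \<kappa>) > 0" using \<kappa> by simp
    \<comment> \<open>In these terms the index has absolute value |a| / (2 l) with a = 2 -
      \<mu>.\<close>
    have "\<bar>boeckx_index \<kappa> \<mu>\<bar> = \<bar>2 - \<mu>\<bar> / (2 * sqrt (1 - \<kappa>))"
      using l by (simp add: boeckx_index_def abs_divide) (simp add: field_simps abs_if)
    then show ?thesis using E0(1) l by (simp add: less_divide_eq)
  qed
  show "\<exists>a b. a \<noteq> b \<and> eigenvalues_on (ker_form A \<eta> p) (T p) = {a, b} \<and>
      eigenspace_on (ker_form A \<eta> p) (T p) a = eigenspace_on (ker_form A \<eta> p) (h p) (sqrt (1 - \<kappa>)) \<and>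
      eigenspace_on (ker_form A \<eta> p) (T p) b = eigenspace_on (ker_form A \<eta> p) (h p) (- sqrt (1 - \<kappa>))"
    for p
    using E0(2-5)[of p] by (intro exI conjI)
  fix T' f' g'
  assume *: "error_solution A B \<eta> \<xi> g\<^sub>M \<pi> \<omega> T' f' g' \<and> commute_on_ker A \<eta> h T'"
  note E1 = E[OF conjunct1[OF *] conjunct2[OF *]]
  show "eigenvalues_on (ker_form A \<eta> p) (T' p) = eigenvalues_on (ker_form A \<eta> p) (T p)"
    if "f' p = f p" for p
    unfolding E0(3) E1(3) that ..
  show "\<forall>X\<in>ker_form A \<eta> p. T' p X = T p X" if "f' p = f p" for p
    by (rule ballI) (simp only: E0(6) E1(6) that)
  show "\<forall>u\<in>tangent_space B b. \<forall>v\<in>tangent_space B b. g b u v = g' b u v" for b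
  proof (intro ballI)
    fix u v assume uv: "u \<in> tangent_space B b" "v \<in> tangent_space B b"
    obtain \<tau> where "principal_circle_bundle A B \<theta> \<tau> \<pi>"
      using fibration by (auto simp: boothby_wang_def)
    then have "surj \<pi>" by (simp add: principal_circle_bundle_def)
    \<comment> \<open>Each base point has a point above it and each tangent vector there a
      horizontal lift, so the formula for the pulled-back metric determines
      \<open>g b\<close>.\<close>
    then obtain p where p: "\<pi> p = b" by (metis surjD)
    obtain c e\<^sub>0 where "regular_chart A B n \<eta> \<xi> g\<^sub>M \<phi> h \<kappa> \<mu> \<theta> \<pi> \<omega> c e\<^sub>0" and pc: "p \<in> chart_dom c"
      using regular_chart_at[OF M flow regular fibration] by blast
    then interpret regular_chart A B n \<eta> \<xi> g\<^sub>M \<phi> h \<kappa> \<mu> \<theta> \<pi> \<omega> c e\<^sub>0 by blast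
    have pt: "pt (chart_map c p) = p" by (rule chart_inv_map[OF chart pc])
    note surj = tangent_map_surj[OF chart_map_in[OF pc], unfolded pt p]
    obtain X Y where X: "X \<in> ker_form A \<eta> p" "tangent_map A B \<pi> p X = u"
      and Y: "Y \<in> ker_form A \<eta> p" "tangent_map A B \<pi> p Y = v"
      using surj[OF uv(1)] surj[OF uv(2)] by blast
    show "g b u v = g' b u v"
      using E0(7)[OF X(1) Y(1)] E1(7)[OF X(1) Y(1)] unfolding X(2) Y(2) p by (simp only:)
  qed
qed

end
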